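(* Let $m$ be a fixed positive integer and let $H_m=\sum_{a=1}^{m}\frac1a$. As $n\to\infty$ (through positive integers), we have $$ \log p(m,n)=\pi\sqrt{\tfrac{2mH_m}{3}}\,\sqrt{n}+O(\log n), $$ where the implied constant may depend on $m$. Moreover, $$ p(m,n)\le\exp\left(\pi\sqrt{\tfrac{2mH_m}{3}}\,\sqrt n\right) $$ for all integers $n\geq m$.
   Context: For positive integers $m,n$, let $R=[0,m]\times[0,n]\subset\mathbb{R}^2$. All rectangles are assumed to have sides parallel to the coordinate axes. A partition of the rectangle $R$ (of size $m\times n$) is a finite multiset $\mathcal{P}=\{R_i\}_{i\in I}$ of integer-sided rectangles (i.e. with positive integer side lengths) such that: (1) rectangles of sizes $a\times b$ and $b\times a$ are regarded as indistinguishable (so a block may be placed in either orientation); (2) all the rectangles from $\mathcal{P}$ can be arranged, with sides parallel to the coordinate axes, in such a way that they cover exactly $R$ and their interiors do not intersect. Two partitions of a rectangle are the same if and only if they are equal as multisets of (unordered) sizes; the geometric arrangement is irrelevant. $p(m,n)$ denotes the number of partitions of a rectangle of size $m\times n$. $\log$ is the natural logarithm. *)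

theory Defs
  imports
    "HOL-Analysis.Analysis"
    "HOL-Library.Multiset"
    "HOL-Library.Uprod"
    "HOL-Library.Landau_Symbols"
begin

definition rect :: "real \<Rightarrow> real \<Rightarrow> nat \<Rightarrow> nat \<Rightarrow> (real \<times> real) set" where
  "rect x y w h = {x..x + real w} \<times> {y..y + real h}"

text \<open>
  A block is recorded by its unordered size \<^term>\<open>Upair w h\<close>, so it may be placed in either
  orientation. The positions \<open>x i\<close>, \<open>y i\<close> of the blocks in an arrangement are arbitrary reals;
  only the side lengths are required to be (positive) integers.
\<close>

definition rect_partition :: "nat \<Rightarrow> nat \<Rightarrow> nat uprod multiset \<Rightarrow> bool" where
  "rect_partition m n P \<longleftrightarrow>
    (\<exists>(I :: nat set) w h x y.
      finite I \<and>
      (\<forall>i\<in>I. w i > 0 \<and> h i > 0) \<and>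
      P = {#Upair (w i) (h i). i \<in># mset_set I#} \<and>
      (\<Union>i\<in>I. rect (x i) (y i) (w i) (h i)) = rect 0 0 m n \<and>
      (\<forall>i\<in>I. \<forall>j\<in>I. i \<noteq> j \<longrightarrow>
        interior (rect (x i) (y i) (w i) (h i)) \<inter> interior (rect (x j) (y j) (w j) (h j)) = {}))"

text \<open>
  The set below is finite, since the areas of the blocks add up to \<open>m * n\<close>; so \<^const>\<open>card\<close> is the
  true number of partitions.
\<close>

definition num_rect_partitions :: "nat \<Rightarrow> nat \<Rightarrow> nat" where
  "num_rect_partitions m n = card {P. rect_partition m n P}"

end

theory Submission
  imports Defs "HOL-Real_Asymp.Real_Asymp"
begin

text \<open>
  Upper bound: a block has one side \<open>a \<le> m\<close>, so \<open>p(m,n)\<close> is at most the number \<open>W(mn)\<close> of multisets of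
  pairs \<open>(a,b)\<close>, \<open>a \<le> m\<close>, of total area \<open>mn\<close>. Double counting gives the recurrence
  \<open>N W(N) = \<Sum> a b W(N - k a b)\<close> over \<open>a, b, k\<close>, and
  \<open>W(N) \<le> exp (C \<surd>N)\<close> follows by induction with exactly the right \<open>C\<close>, since
  \<open>\<Sum>b. b e\<^sup>-\<^sup>y\<^sup>b \<le> 1/y\<^sup>2\<close> and \<open>\<Sum>k. 1/k\<^sup>2 = \<pi>\<^sup>2/6\<close>.

  Lower bound: the same recurrence for the partition function, used in the other direction,
  gives \<open>p(N) \<ge> \<delta> N\<^sup>-\<^sup>B exp (\<pi> \<surd>(2N/3))\<close>; a polynomial factor of slack absorbs the
  second-order error terms. Up to another polynomial factor one may count only partitions into parts
  between \<open>m\<close> and \<open>K = O(\<surd>n log n)\<close>. For every \<open>a \<le> m\<close> choose such a partition of total length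
  about \<open>n m/(H\<^sub>m a\<^sup>2)\<close> and turn its parts into blocks of width \<open>a\<close>. Arrange the blocks of width
  \<open>a > 1\<close> in \<open>m div a\<close> parallel rows of almost equal length, put those of width 1 into the remaining
  rows, and fill the gaps with unit squares. There is room for the rows because
  \<open>\<Sum>a=2..m. m/(a\<^sup>2 (m div a)) \<le> H\<^sub>m\<close>, and the chosen partitions can be recovered from the tiling.
\<close>

section \<open>Weighted multisets\<close>

definition weighted_msets :: "('a \<Rightarrow> nat) \<Rightarrow> 'a set \<Rightarrow> nat \<Rightarrow> 'a multiset set" where
  "weighted_msets w S n = {X. set_mset X \<subseteq> S \<and> (\<Sum>x\<in>#X. w x) = n}"

definition num_weighted :: "('a \<Rightarrow> nat) \<Rightarrow> 'a set \<Rightarrow> nat \<Rightarrow> nat" where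
  "num_weighted w S n = card (weighted_msets w S n)"

lemma sum_mset_eq_sum_count:
  fixes w :: "'a \<Rightarrow> nat"
  assumes "finite T" "set_mset X \<subseteq> T"
  shows "(\<Sum>x\<in>#X. w x) = (\<Sum>s\<in>T. count X s * w s)"
  using assms(2)
proof (induction X)
  case (add a X)
  have "(\<Sum>s\<in>T. count (add_mset a X) s * w s) = (\<Sum>s\<in>T. count X s * w s + (if s = a then w a else 0))"
    by (intro sum.cong) auto
  also have "\<dots> = (\<Sum>s\<in>T. count X s * w s) + w a"
    using add.prems assms(1) by (simp add: sum.distrib)
  finally show ?case
    using add by simp
qed simp

lemma member_le_weight:
  fixes w :: "'a \<Rightarrow> nat"
  assumes "x \<in># X"
  shows "w x \<le> (\<Sum>x\<in>#X. w x)"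
  using assms by (metis insert_DiffM le_add1 sum_mset.insert image_mset_add_mset)

text \<open>Every element adds at least 1 to the weight and only finitely many have weight at most
  \<open>n\<close>, so there are finitely many multisets of total weight \<open>n\<close> even when
  \<open>S\<close> is infinite.\<close>

locale weights =
  fixes w :: "'a \<Rightarrow> nat" and S :: "'a set"
  assumes weight_pos: "s \<in> S \<Longrightarrow> w s > 0"
    and finite_weight_le: "finite {s \<in> S. w s \<le> n}"
begin

lemma size_le_weight:
  assumes "set_mset X \<subseteq> S"
  shows "size X \<le> (\<Sum>x\<in>#X. w x)"
  using assms
proof (induction X)
  case (add x X)
  then show ?case using weight_pos[of x] by auto
qed simp

lemma finite_weighted_msets: "finite (weighted_msets w S n)"
proof (rule finite_subset)
  show "weighted_msets w S n \<subseteq> (\<Union>k\<le>n. multisets_of_size {s \<in> S. w s \<le> n} k)"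
  proof
    fix X assume X: "X \<in> weighted_msets w S n"
    then have "set_mset X \<subseteq> {s \<in> S. w s \<le> n}" "size X \<le> n"
      using size_le_weight[of X] member_le_weight[of _ X w] by (auto simp: weighted_msets_def)
    then show "X \<in> (\<Union>k\<le>n. multisets_of_size {s \<in> S. w s \<le> n} k)"
      by (auto simp: multisets_of_size_def)
  qed
  show "finite (\<Union>k\<le>n. multisets_of_size {s \<in> S. w s \<le> n} k)"
    by (intro finite_UN_I finite_multisets_of_size finite_weight_le) auto
qed

lemma num_weighted_0 [simp]: "num_weighted w S 0 = 1"
proof -
  have "weighted_msets w S 0 = {{#}}"
  proof -
    have "X = {#}" if "set_mset X \<subseteq> S" "(\<Sum>x\<in>#X. w x) = 0" for X
      using size_le_weight[of X] that by auto
    then show ?thesis by (auto simp: weighted_msets_def)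
  qed
  then show ?thesis by (simp add: num_weighted_def)
qed

text \<open>Removing \<open>k\<close> copies of \<open>s\<close> is a bijection onto the multisets
  of weight \<open>n - k * w s\<close>. The case distinction is there because for
  \<open>k * w s > n\<close> the truncated difference would be 0 and the count 1.\<close>

lemma card_count_ge:
  assumes "s \<in> S"
  shows "card {X \<in> weighted_msets w S n. k \<le> count X s} =
    (if k * w s \<le> n then num_weighted w S (n - k * w s) else 0)"
proof (cases "k * w s \<le> n")
  case True
  have "bij_betw (\<lambda>X. X + replicate_mset k s) (weighted_msets w S (n - k * w s))
     {X \<in> weighted_msets w S n. k \<le> count X s}"
  proof (rule bij_betw_byWitness[where f' = "\<lambda>X. X - replicate_mset k s"])
    show "(\<lambda>X. X + replicate_mset k s) ` weighted_msets w S (n - k * w s)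
        \<subseteq> {X \<in> weighted_msets w S n. k \<le> count X s}"
      using True assms by (auto simp: weighted_msets_def split: if_splits)
    show "(\<lambda>X. X - replicate_mset k s) ` {X \<in> weighted_msets w S n. k \<le> count X s}
        \<subseteq> weighted_msets w S (n - k * w s)"
    proof safe
      fix X assume X: "X \<in> weighted_msets w S n" "k \<le> count X s"
      define Y where "Y = X - replicate_mset k s"
      have "X = Y + replicate_mset k s"
        using X(2) by (simp add: Y_def count_le_replicate_mset_subset_eq)
      with X show "X - replicate_mset k s \<in> weighted_msets w S (n - k * w s)"
        by (auto simp: weighted_msets_def Y_def[symmetric])
    qed
  qed (auto simp: count_le_replicate_mset_subset_eq)
  then show ?thesis using True bij_betw_same_card by (fastforce simp: num_weighted_def)
next
  case False
  have "k * w s \<le> n" if "X \<in> weighted_msets w S n" "k \<le> count X s" for X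
  proof -
    have "replicate_mset k s \<subseteq># X" using that by (simp add: count_le_replicate_mset_subset_eq)
    then obtain Y where "X = replicate_mset k s + Y" by (metis subset_mset.add_diff_inverse)
    with that show ?thesis by (auto simp: weighted_msets_def)
  qed
  with False have "{X \<in> weighted_msets w S n. k \<le> count X s} = {}" by auto
  with False show ?thesis by (simp only: card.empty if_False)
qed

text \<open>
  Both sides count the total weight of all elements of all multisets in \<^term>\<open>weighted_msets w S n\<close>.
\<close>
lemma num_weighted_recurrence:
  "n * num_weighted w S n =
     (\<Sum>s | s \<in> S \<and> w s \<le> n. \<Sum>k | 1 \<le> k \<and> k * w s \<le> n. w s * num_weighted w S (n - k * w s))"
proof -
  let ?T = "{s \<in> S. w s \<le> n}" and ?W = "weighted_msets w S n"
  have count: "(\<Sum>X\<in>?W. count X s) = (\<Sum>k | 1 \<le> k \<and> k * w s \<le> n. num_weighted w S (n - k * w s))"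
    if s: "s \<in> ?T" for s
  proof -
    have le: "k * w s \<le> n \<Longrightarrow> k \<le> n" for k
      using weight_pos[of s] s by (metis (no_types, lifting) One_nat_def Suc_leI le_trans mem_Collect_eq mult.right_neutral mult_le_mono2)
    have cn: "count X s \<le> n" if "X \<in> ?W" for X
      using that size_le_weight[of X] count_le_size[of X s] by (auto simp: weighted_msets_def)
    \<comment> \<open>The multiplicity of \<open>s\<close> is the number of levels \<open>k\<close>
      that it reaches; exchanging the sums leads to \<open>card_count_ge\<close>.\<close>
    have "(\<Sum>X\<in>?W. count X s) = (\<Sum>X\<in>?W. \<Sum>k=1..n. if k \<le> count X s then 1 else 0)"
    proof (intro sum.cong refl)
      fix X assume "X \<in> ?W"
      have "{1..n} \<inter> {k. k \<le> count X s} = {1..count X s}" using cn[OF \<open>X \<in> ?W\<close>] by auto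
      then show "count X s = (\<Sum>k=1..n. if k \<le> count X s then 1 else 0)"
        by (simp add: sum.If_cases)
    qed
    also have "\<dots> = (\<Sum>k=1..n. card {X \<in> ?W. k \<le> count X s})"
      by (subst sum.swap) (simp add: finite_weighted_msets sum.If_cases Collect_conj_eq Int_commute)
    also have "\<dots> = (\<Sum>k=1..n. if k * w s \<le> n then num_weighted w S (n - k * w s) else 0)"
      using s by (intro sum.cong refl card_count_ge) auto
    also have "\<dots> = (\<Sum>k\<in>{k\<in>{1..n}. k * w s \<le> n}. num_weighted w S (n - k * w s))"
      by (rule sum.inter_filter[symmetric]) simp
    also have "{k\<in>{1..n}. k * w s \<le> n} = {k. 1 \<le> k \<and> k * w s \<le> n}"
      using le by auto
    finally show ?thesis .
  qed
  have "n * num_weighted w S n = (\<Sum>X\<in>?W. \<Sum>x\<in>#X. w x)"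
    by (simp add: num_weighted_def weighted_msets_def)
  also have "\<dots> = (\<Sum>X\<in>?W. \<Sum>s\<in>?T. count X s * w s)"
    by (intro sum.cong refl sum_mset_eq_sum_count finite_weight_le)
       (auto simp: weighted_msets_def member_le_weight)
  also have "\<dots> = (\<Sum>s\<in>?T. w s * (\<Sum>X\<in>?W. count X s))"
    by (subst sum.swap) (simp add: sum_distrib_left mult.commute)
  also have "\<dots> = (\<Sum>s\<in>?T. w s * (\<Sum>k | 1 \<le> k \<and> k * w s \<le> n. num_weighted w S (n - k * w s)))"
    by (intro sum.cong refl) (simp only: count)
  finally show ?thesis by (simp add: sum_distrib_left)
qed

end

section \<open>The upper bound\<close>

lemma real_le_two_sinh_half:
  fixes y :: real
  assumes "y \<ge> 0"
  shows "y \<le> exp (y / 2) - exp (- y / 2)"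
  using real_le_x_sinh[of "y / 2"] assms by (simp add: exp_minus)

lemma two_sinh_half_le:
  fixes y :: real
  assumes "y \<ge> 0" "y \<le> 1"
  shows "exp (y / 2) - exp (- y / 2) \<le> y + y ^ 3 / 3"
proof -
  define g where "g = (\<lambda>t::real. t + t ^ 3 / 3 - (exp (t / 2) - exp (- t / 2)))"
  have "g 0 \<le> g y"
  proof (rule DERIV_nonneg_imp_nondecreasing[OF assms(1)])
    fix t :: real assume t: "0 \<le> t" "t \<le> y"
    have "(g has_real_derivative 1 + t\<^sup>2 - (exp (t/2) + exp (- t/2)) / 2) (at t)"
      unfolding g_def by (auto intro!: derivative_eq_intros simp: field_simps)
    moreover have "exp (t/2) \<le> 1 + t/2 + (t/2)\<^sup>2"
      using t assms by (intro exp_bound) auto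
    moreover have "exp (- t/2) \<le> 1 - t/2 + (t/2)\<^sup>2"
    proof -
      \<comment> \<open>With \<open>u = t/2\<close> the product is \<open>1 + u^3\<close>, which
        turns a lower bound for \<open>exp u\<close> into an upper bound for
        \<open>exp (- u)\<close>.\<close>
      have "1 \<le> (1 - t/2 + (t/2)\<^sup>2) * (1 + t/2)"
        using t assms by (simp add: algebra_simps power2_eq_square)
      also have "\<dots> \<le> (1 - t/2 + (t/2)\<^sup>2) * exp (t/2)"
        using t assms exp_ge_add_one_self[of "t/2"] by (intro mult_left_mono) auto
      finally show ?thesis
        by (simp add: exp_minus field_simps)
    qed
    moreover have "(t/2)\<^sup>2 = t\<^sup>2 / 4" by (simp add: power_divide)
    ultimately show "\<exists>z. (g has_real_derivative z) (at t) \<and> 0 \<le> z"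
      using zero_le_power2[of t] by (intro exI[of _ "1 + t\<^sup>2 - (exp (t/2) + exp (- t/2)) / 2"] conjI) (assumption, argo)
  qed
  then show ?thesis by (simp add: g_def)
qed

text \<open>With \<open>q = exp (- y)\<close> the sum of \<open>v * q^v\<close> is
  \<open>q / (1 - q)^2\<close>; dividing by \<open>q\<close> above and below produces the square of
  \<open>2 sinh (y/2)\<close>, which is easy to compare with \<open>y\<close>.\<close>

lemma sums_nat_times_exp:
  fixes y :: real
  assumes "y > 0"
  shows "(\<lambda>v. real v * exp (- y * real v)) sums (1 / (exp (y / 2) - exp (- y / 2))\<^sup>2)"
proof -
  define q where "q = exp (- y)"
  have q: "norm q < 1" using assms by (simp add: q_def)
  have "(\<lambda>n. q * (real (Suc n) * q ^ n)) sums (q * (1 / (1 - q)\<^sup>2))"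
    by (intro sums_mult geometric_deriv_sums q)
  then have "(\<lambda>n. real (Suc n) * exp (- y * real (Suc n))) sums (q * (1 / (1 - q)\<^sup>2))"
    by (rule sums_cong[THEN iffD1, rotated])
       (simp add: q_def exp_of_nat_mult[symmetric] exp_add[symmetric] algebra_simps)
  then have "(\<lambda>n. real n * exp (- y * real n)) sums (q * (1 / (1 - q)\<^sup>2))"
    by (subst (asm) sums_Suc_iff) simp
  moreover have "q * (1 / (1 - q)\<^sup>2) = 1 / (exp (y / 2) - exp (- y / 2))\<^sup>2"
  proof -
    have "(1 - q)\<^sup>2 = q * (exp (y / 2) - exp (- y / 2))\<^sup>2"
      by (simp add: q_def power2_eq_square algebra_simps exp_add[symmetric])
    moreover have "q > 0" "q \<noteq> 1" using assms by (auto simp: q_def)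
    ultimately show ?thesis by (simp add: field_simps)
  qed
  ultimately show ?thesis by simp
qed

lemma nat_times_exp_le:
  fixes y :: real
  assumes "y > 0"
  shows "1 / (exp (y / 2) - exp (- y / 2))\<^sup>2 \<le> 1 / y\<^sup>2"
  using real_le_two_sinh_half[of y] assms by (intro divide_left_mono power_mono mult_pos_pos zero_less_power) auto

text \<open>Together with \<open>nat_times_exp_le\<close> this fixes the series up to an additive 1.
  It combines \<open>(1 + y^2/3)^2 \<le> 1 + y^2\<close> with
  \<open>1 / (1 + y^2) \<ge> 1 - y^2\<close>.\<close>

lemma nat_times_exp_ge:
  fixes y :: real
  assumes "y > 0" "y \<le> 1"
  shows "1 / (exp (y / 2) - exp (- y / 2))\<^sup>2 \<ge> 1 / y\<^sup>2 - 1"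
proof -
  let ?e = "exp (y / 2) - exp (- y / 2)"
  have "?e\<^sup>2 \<le> (y + y ^ 3 / 3)\<^sup>2"
    using two_sinh_half_le[of y] real_le_two_sinh_half[of y] assms by (intro power_mono) auto
  also have "\<dots> = y\<^sup>2 * (1 + y\<^sup>2 / 3)\<^sup>2" by (simp add: power2_eq_square power3_eq_cube algebra_simps)
  also have "(1 + y\<^sup>2 / 3)\<^sup>2 \<le> 1 + y\<^sup>2"
  proof -
    have "y\<^sup>2 \<le> 1" using assms by (simp add: power_le_one)
    then have "y\<^sup>2 * y\<^sup>2 \<le> y\<^sup>2 * 1" by (intro mult_left_mono) auto
    moreover have "(1 + y\<^sup>2 / 3)\<^sup>2 = 1 + 2 / 3 * y\<^sup>2 + (y\<^sup>2 * y\<^sup>2) / 9"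
      by (simp add: power2_eq_square algebra_simps)
    ultimately show ?thesis using zero_le_power2[of y] by argo
  qed
  finally have 1: "?e\<^sup>2 \<le> y\<^sup>2 * (1 + y\<^sup>2)" by (simp add: mult_left_mono)
  have e: "?e > 0" using real_le_two_sinh_half[of y] assms by auto
  have "1 / y\<^sup>2 - 1 \<le> 1 / (y\<^sup>2 * (1 + y\<^sup>2))"
  proof -
    have "(1 - y\<^sup>2) * (1 + y\<^sup>2) \<le> 1" by (simp add: algebra_simps)
    then have "1 - y\<^sup>2 \<le> 1 / (1 + y\<^sup>2)" by (subst pos_le_divide_eq) (auto simp: add_pos_nonneg)
    then have "(1 - y\<^sup>2) / y\<^sup>2 \<le> (1 / (1 + y\<^sup>2)) / y\<^sup>2" by (rule divide_right_mono) simp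
    then show ?thesis using assms by (simp add: diff_divide_distrib mult.commute)
  qed
  also have "\<dots> \<le> 1 / ?e\<^sup>2" using 1 e assms by (intro divide_left_mono mult_pos_pos) (auto simp: add_pos_nonneg)
  finally show ?thesis .
qed

lemma sum_inverse_squares_le: "(\<Sum>k=1..n. 1 / real k ^ 2) \<le> pi\<^sup>2 / 6"
proof -
  have "(\<Sum>k=1..n. 1 / real k ^ 2) = (\<Sum>k<n. 1 / real (k + 1) ^ 2)"
    by (rule sum.reindex_bij_witness[of _ "\<lambda>k. k + 1" "\<lambda>k. k - 1"]) auto
  also have "\<dots> \<le> (\<Sum>k. 1 / real (k + 1) ^ 2)"
    using inverse_squares_sums by (intro sum_le_suminf) (auto simp: sums_iff)
  also have "\<dots> = pi\<^sup>2 / 6"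
    using inverse_squares_sums by (simp add: sums_iff)
  finally show ?thesis .
qed

text \<open>The tail beyond \<open>n\<close> is bounded by telescoping, since
  \<open>1 / (k+1)^2 \<le> 1/k - 1/(k+1)\<close>.\<close>

lemma sum_inverse_squares_ge:
  assumes "n \<ge> 1"
  shows "(\<Sum>k=1..n. 1 / real k ^ 2) \<ge> pi\<^sup>2 / 6 - 1 / real n"
proof -
  let ?f = "\<lambda>k. \<Sum>k=1..k. 1 / real k ^ 2"
  have lim: "?f \<longlonglongrightarrow> pi\<^sup>2 / 6"
  proof -
    have "?f k = (\<Sum>k<k. 1 / real (k + 1) ^ 2)" for k
      by (rule sum.reindex_bij_witness[of _ "\<lambda>k. k + 1" "\<lambda>k. k - 1"]) auto
    then show ?thesis using inverse_squares_sums by (simp add: sums_def)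
  qed
  have "?f (n + j) \<le> ?f n + 1 / real n - 1 / real (n + j)" for j
  proof (induction j)
    case (Suc j)
    have n: "real n + real j > 0" using assms by simp
    have "1 / (real n + real j + 1)\<^sup>2 \<le> 1 / ((real n + real j) * (real n + real j + 1))"
      using n by (intro divide_left_mono) (auto simp: power2_eq_square)
    also have "\<dots> = 1 / (real n + real j) - 1 / (real n + real j + 1)"
      using n by (simp add: field_simps)
    finally show ?case using Suc by (simp add: add_ac)
  qed simp
  then have "?f (n + j) \<le> ?f n + 1 / real n" for j
    by (rule order_trans) simp
  then have "pi\<^sup>2 / 6 \<le> ?f n + 1 / real n"
    by (intro tendsto_upperbound[OF LIMSEQ_ignore_initial_segment[OF lim, of n]])
       (auto simp: add.commute)
  then show ?thesis by simp
qed

text \<open>The tangent of the concave square root at \<open>n\<close>, obtained from the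
  arithmetic-geometric mean inequality for \<open>n\<close> and \<open>n - x\<close>.\<close>

lemma sqrt_diff_le:
  assumes "n > 0" "x \<le> n"
  shows "sqrt (n - x) \<le> sqrt n - x / (2 * sqrt n)"
proof -
  have "sqrt (n * (n - x)) \<le> (n + (n - x)) / 2"
    using arith_geo_mean_sqrt[of n "n - x"] assms by simp
  then have "sqrt n * sqrt (n - x) \<le> n - x / 2"
    by (simp add: real_sqrt_mult)
  then have "sqrt (n - x) \<le> (n - x / 2) / sqrt n"
    using assms by (subst pos_le_divide_eq) (auto simp: mult.commute)
  also have "\<dots> = sqrt n - x / (2 * sqrt n)"
    using assms by (simp add: diff_divide_distrib real_div_sqrt)
  finally show ?thesis .
qed

section \<open>Multisets of blocks of bounded width\<close>

lemma weights_blocks: "weights (\<lambda>(a, b). a * b) ({1..m} \<times> {1..})"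
proof
  fix n
  have "{s \<in> {1..m} \<times> {1..}. (case s of (a, b) \<Rightarrow> a * b) \<le> n} \<subseteq> {1..m} \<times> {1..n}"
    by (auto elim!: order_trans[rotated])
  then show "finite {s \<in> {1..m} \<times> {1..}. (case s of (a, b) \<Rightarrow> a * b) \<le> n}"
    by (rule finite_subset) simp
qed auto

lemma num_weighted_blocks_le:
  fixes m :: nat
  assumes "m \<ge> 1"
  shows "real (num_weighted (\<lambda>(a, b). a * b) ({1..m} \<times> {1..}) n)
    \<le> exp (pi * sqrt (2 * harm m / 3) * sqrt (real n))"
proof (induction n rule: less_induct)
  case (less n)
  interpret weights "\<lambda>(a, b). a * b" "{1..m} \<times> {1..}" by (rule weights_blocks)
  let ?S = "{1..m} \<times> {1..}"
  let ?P = "num_weighted (\<lambda>(a, b). a * b) ?S"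
  define C where "C = pi * sqrt (2 * harm m / 3)"
  have H: "(harm m :: real) > 0" using assms by (intro harm_pos) auto
  show ?case
  proof (cases "n = 0")
    case False
    \<comment> \<open>\<open>s\<close> is the slope of \<open>C * sqrt x\<close> at
      \<open>x = n\<close>, so each removed unit of area costs the bound a factor
      \<open>exp (- s)\<close>.\<close>
    define s where "s = C / (2 * sqrt (real n))"
    have s: "s > 0" using False H by (simp add: s_def C_def)
    have P_le: "real (?P (n - x)) \<le> exp (C * sqrt n) * exp (- s * x)" if "1 \<le> x" "x \<le> n" for x
    proof -
      have "real (?P (n - x)) \<le> exp (C * sqrt (real (n - x)))"
        using less.IH[of "n - x"] that by (simp add: C_def)
      also have "C * sqrt (real (n - x)) \<le> C * (sqrt n - x / (2 * sqrt n))"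
        using sqrt_diff_le[of "real n" "real x"] that H
        by (intro mult_left_mono) (auto simp: of_nat_diff C_def less_imp_le)
      finally show ?thesis by (simp add: exp_add[symmetric] s_def algebra_simps)
    qed
    define T where "T = (SIGMA ab : {ab \<in> ?S. (case ab of (a, b) \<Rightarrow> a * b) \<le> n}.
        {k. 1 \<le> k \<and> k * (case ab of (a, b) \<Rightarrow> a * b) \<le> n})"
    have finT2: "finite {k. 1 \<le> k \<and> k * (case ab of (a, b) \<Rightarrow> a * b) \<le> n}" if "ab \<in> ?S" for ab
    proof (rule finite_subset)
      show "{k. 1 \<le> k \<and> k * (case ab of (a, b) \<Rightarrow> a * b) \<le> n} \<subseteq> {..n}"
        using that by (auto intro: order_trans[rotated])
    qed simp
    have T_sub: "T \<subseteq> ({1..m} \<times> {1..n}) \<times> {1..n}"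
    proof (rule subsetI)
      fix t assume "t \<in> T"
      then obtain a b k where t: "t = ((a, b), k)" "1 \<le> a" "a \<le> m" "1 \<le> b" "1 \<le> k" "k * (a * b) \<le> n"
        by (auto simp: T_def)
      moreover have "1 * b \<le> k * a * b" "1 * k \<le> a * b * k"
        using t by (intro mult_le_mono1; simp)+
      ultimately have "b \<le> n" "k \<le> n"
        by (metis mult.assoc mult_1 order_trans, metis mult.commute mult_1 order_trans)
      then show "t \<in> ({1..m} \<times> {1..n}) \<times> {1..n}" using t by simp
    qed
    have "real n * ?P n = real (n * ?P n)" by simp
    also have "\<dots> = (\<Sum>((a, b), k)\<in>T. real (a * b) * ?P (n - k * (a * b)))"
      unfolding num_weighted_recurrence T_def
      using finite_weight_le[of n] finT2
      by (subst sum.Sigma) (auto intro!: sum.cong simp: case_prod_unfold)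
    also have "\<dots> \<le> (\<Sum>((a, b), k)\<in>T. real (a * b) * (exp (C * sqrt n) * exp (- s * real (k * (a * b)))))"
    proof (rule sum_mono)
      fix t assume "t \<in> T"
      then obtain a b k where t: "t = ((a, b), k)" "1 \<le> k * (a * b)" "k * (a * b) \<le> n"
        by (auto simp: T_def)
      show "(\<lambda>((a, b), k). real (a * b) * ?P (n - k * (a * b))) t
          \<le> (\<lambda>((a, b), k). real (a * b) * (exp (C * sqrt n) * exp (- s * real (k * (a * b))))) t"
        unfolding t(1) prod.case using t by (intro mult_left_mono P_le) auto
    qed
    \<comment> \<open>All terms are nonnegative, so the index set may be enlarged to a box, where
      the sum over \<open>b\<close> can be taken separately for each \<open>a\<close> and
      \<open>k\<close>.\<close>
    also have "\<dots> \<le> (\<Sum>((a, b), k)\<in>({1..m} \<times> {1..n}) \<times> {1..n}.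
        real (a * b) * (exp (C * sqrt n) * exp (- s * real (k * (a * b)))))"
      by (intro sum_mono2 T_sub) auto
    also have "\<dots> = exp (C * sqrt n) * (\<Sum>a=1..m. \<Sum>k=1..n. a * (\<Sum>b=1..n. b * exp (- (s * k * a) * b)))"
    proof -
      have "(\<Sum>b=1..n. \<Sum>k=1..n. real (a * b) * (exp (C * sqrt n) * exp (- s * real (k * (a * b)))))
          = exp (C * sqrt n) * (\<Sum>k=1..n. a * (\<Sum>b=1..n. b * exp (- (s * k * a) * b)))" for a
        by (subst sum.swap) (simp add: sum_distrib_left mult_ac)
      then show ?thesis
        by (simp only: sum.cartesian_product' prod.case sum_distrib_left)
    qed
    also have "\<dots> \<le> exp (C * sqrt n) * (\<Sum>a=1..m. \<Sum>k=1..n. a * (1 / (s * k * a)\<^sup>2))"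
    proof (intro mult_left_mono sum_mono)
      fix a k :: nat assume ak: "a \<in> {1..m}" "k \<in> {1..n}"
      let ?y = "s * k * a"
      have y: "?y > 0" using s ak by simp
      have "(\<Sum>b=1..n. b * exp (- ?y * b)) \<le> (\<Sum>b. b * exp (- ?y * b))"
        using sums_nat_times_exp[OF y] by (intro sum_le_suminf) (auto simp: sums_iff)
      also have "\<dots> \<le> 1 / ?y\<^sup>2"
        using sums_nat_times_exp[OF y] nat_times_exp_le[OF y] by (simp add: sums_iff)
      finally show "(\<Sum>b=1..n. b * exp (- ?y * b)) \<le> 1 / ?y\<^sup>2" .
    qed auto
    also have "(\<Sum>a=1..m. \<Sum>k=1..n. a * (1 / (s * k * a)\<^sup>2)) = harm m * (\<Sum>k=1..n. 1 / real k ^ 2) / s\<^sup>2"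
      unfolding harm_def
      by (simp add: sum_product sum_divide_distrib field_simps power2_eq_square)
    also have "\<dots> \<le> harm m * (pi\<^sup>2 / 6) / s\<^sup>2"
      by (intro divide_right_mono mult_left_mono sum_inverse_squares_le) (auto simp: harm_nonneg)
    \<comment> \<open>\<open>C\<close> is chosen for this identity:
      \<open>C^2 = 2 * pi^2 * harm m / 3\<close> and \<open>s^2 = C^2 / (4 * n)\<close>.\<close>
    also have "\<dots> = real n"
    proof -
      have "C\<^sup>2 = pi\<^sup>2 * (2 * harm m / 3)"
        using H unfolding C_def power_mult_distrib by (subst real_sqrt_pow2) (auto simp: harm_nonneg)
      moreover have "harm m \<noteq> (0::real)" using H by (rule less_imp_neq[symmetric])
      ultimately show ?thesis using False unfolding s_def power_divide power_mult_distrib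
        by (simp add: field_simps)
    qed
    finally have "real n * ?P n \<le> real n * exp (C * sqrt n)" by (simp add: mult.commute)
    then show ?thesis using False by (simp add: C_def)
  next
    case True
    then show ?thesis by (simp only: num_weighted_0) simp
  qed
qed

section \<open>The partition function\<close>

abbreviation num_parts :: "nat \<Rightarrow> nat" where
  "num_parts \<equiv> num_weighted (\<lambda>x. x) {1..}"

lemma weights_parts: "weights (\<lambda>x. x) {1..}"
proof
  fix n :: nat
  show "finite {s \<in> {1..}. s \<le> n}" by (rule finite_subset[of _ "{..n}"]) auto
qed auto

interpretation parts: weights "\<lambda>x. x" "{1..}" by (rule weights_parts)

text \<open>The case \<open>m = 1\<close> of \<open>num_weighted_blocks_le\<close>: a part
  \<open>x\<close> becomes the block \<open>(1, x)\<close>, and \<open>harm 1 = 1\<close>.\<close>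

lemma num_parts_le: "real (num_parts n) \<le> exp (pi * sqrt (2 / 3) * sqrt (real n))"
proof -
  interpret blocks: weights "\<lambda>(a, b). a * b" "{1..1} \<times> {1..}" by (rule weights_blocks)
  have "num_parts n \<le> num_weighted (\<lambda>(a, b). a * b) ({1..1} \<times> {1..}) n"
    unfolding num_weighted_def
  proof (rule card_inj_on_le[OF _ _ blocks.finite_weighted_msets])
    show "inj_on (image_mset (Pair 1)) (weighted_msets (\<lambda>x. x) {1..} n)"
      by (intro inj_on_subset[OF multiset.inj_map] injI) auto
  qed (auto simp: weighted_msets_def image_mset.compositionality comp_def)
  then show ?thesis
    using num_weighted_blocks_le[of 1 n] by (simp add: harm_def)
qed

lemma num_parts_ge_1: "num_parts n \<ge> 1"
proof -
  have "(if n = 0 then {#} else {#n#}) \<in> weighted_msets (\<lambda>x. x) {1..} n"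
    by (auto simp: weighted_msets_def)
  then show ?thesis
    unfolding num_weighted_def
    by (metis One_nat_def Suc_leI card_gt_0_iff empty_iff parts.finite_weighted_msets)
qed

section \<open>Lower bound for the partition function\<close>

lemma sqrt_diff_ge:
  fixes n x :: real
  assumes "n > 0" "0 \<le> x" "x \<le> n"
  shows "sqrt (n - x) \<ge> sqrt n - x / (2 * sqrt n) - x\<^sup>2 / (2 * sqrt n ^ 3)"
proof -
  define u where "u = x / n"
  have u: "0 \<le> u" "u \<le> 1" "x = n * u" using assms by (auto simp: u_def)
  \<comment> \<open>After division by \<open>sqrt n\<close> the claim is
    \<open>(1 - u) * (1 + u/2) \<le> sqrt (1 - u)\<close>. It follows from
    \<open>sqrt (1 - u) * (1 + u/2) \<le> 1\<close>, which is checked by squaring.\<close>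
  have "(sqrt (1 - u) * (1 + u / 2))\<^sup>2 = 1 - 3 / 4 * u\<^sup>2 - u ^ 3 / 4"
    using u by (simp add: power_mult_distrib power2_eq_square power3_eq_cube field_simps)
  also have "\<dots> \<le> 1\<^sup>2" using zero_le_power2[of u] zero_le_power[OF u(1), of 3] unfolding one_power2 by argo
  finally have "sqrt (1 - u) * (1 + u / 2) \<le> 1" by (rule power2_le_imp_le) simp
  then have "sqrt (1 - u) * (sqrt (1 - u) * (1 + u / 2)) \<le> sqrt (1 - u) * 1"
    using u by (intro mult_left_mono) auto
  then have "(1 - u) * (1 + u / 2) \<le> sqrt (1 - u)"
    using u by (simp add: mult.assoc[symmetric])
  then have "sqrt n * ((1 - u) * (1 + u / 2)) \<le> sqrt n * sqrt (1 - u)"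
    using assms by (intro mult_left_mono) auto
  also have "\<dots> = sqrt (n - x)" by (simp add: real_sqrt_mult[symmetric] u algebra_simps)
  also have "sqrt n * ((1 - u) * (1 + u / 2)) = sqrt n - x / (2 * sqrt n) - x\<^sup>2 / (2 * sqrt n ^ 3)"
  proof -
    define r where "r = sqrt n"
    have "r > 0" "n = r\<^sup>2" using assms by (auto simp: r_def)
    then show ?thesis unfolding r_def[symmetric] u(3)
      by (simp add: field_simps power2_eq_square power3_eq_cube)
  qed
  finally show ?thesis .
qed

text \<open>Half of the exponent absorbs two powers of \<open>v\<close>: with
  \<open>t = y * v / 4\<close>, \<open>t^2 \<le> exp (2 * t)\<close>. What remains is the series of
  \<open>sums_nat_times_exp\<close> at \<open>y/2\<close>.\<close>

lemma sum_cube_exp_le: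
  fixes y :: real
  assumes "y > 0"
  shows "(\<Sum>v<n. real v ^ 3 * exp (- y * real v)) \<le> 64 / y ^ 4"
proof -
  have "real v ^ 3 * exp (- y * real v) \<le> 16 / y\<^sup>2 * (real v * exp (- (y / 2) * real v))" for v
  proof -
    define t where "t = y * real v / 4"
    have t: "t \<ge> 0" using assms by (simp add: t_def)
    have "t\<^sup>2 \<le> (exp t)\<^sup>2" using t exp_ge_add_one_self[of t] by (intro power_mono) linarith+
    also have "\<dots> = exp (2 * t)" by (simp add: exp_double)
    finally have "t\<^sup>2 * exp (- 4 * t) \<le> exp (2 * t) * exp (- 4 * t)" by (rule mult_right_mono) simp
    then have "t\<^sup>2 * exp (- 4 * t) \<le> exp (- 2 * t)" by (simp add: exp_add[symmetric])
    then have "16 / y\<^sup>2 * real v * (t\<^sup>2 * exp (- 4 * t)) \<le> 16 / y\<^sup>2 * real v * exp (- 2 * t)"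
      by (intro mult_left_mono) auto
    then show ?thesis using assms by (simp add: t_def power_divide power2_eq_square power3_eq_cube field_simps)
  qed
  then have "(\<Sum>v<n. real v ^ 3 * exp (- y * real v)) \<le> 16 / y\<^sup>2 * (\<Sum>v<n. real v * exp (- (y / 2) * real v))"
    by (simp add: sum_distrib_left sum_mono)
  also have "16 / y\<^sup>2 * (\<Sum>v<n. real v * exp (- (y / 2) * real v)) \<le> 16 / y\<^sup>2 * (1 / (y / 2)\<^sup>2)"
  proof (rule mult_left_mono)
    have "(\<Sum>v<n. real v * exp (- (y / 2) * real v)) \<le> (\<Sum>v. real v * exp (- (y / 2) * real v))"
    using sums_nat_times_exp[of "y / 2"] assms by (intro sum_le_suminf) (auto simp: sums_iff)
    also have "\<dots> \<le> 1 / (y / 2)\<^sup>2"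
      using sums_nat_times_exp[of "y / 2"] nat_times_exp_le[of "y / 2"] assms by (simp add: sums_iff)
    finally show "(\<Sum>v<n. real v * exp (- (y / 2) * real v)) \<le> 1 / (y / 2)\<^sup>2" .
  qed simp
  finally show ?thesis by (simp add: power_divide power2_eq_square power4_eq_xxxx)
qed

lemma sum_squares_ge: "real n ^ 3 / 3 \<le> (\<Sum>v\<le>n. real v ^ 2)"
  by (induction n) (auto simp: power2_eq_square power3_eq_cube algebra_simps add_divide_distrib)

text \<open>
  The factor \<open>1 + \<beta> v - \<gamma> v\<^sup>2\<close> is nonpositive outside \<open>F\<close>, so that the sum over \<open>F\<close> can be
  bounded below by the complete series.
\<close>
lemma truncated_sum_ge:
  fixes y \<beta> \<gamma> :: real
  assumes "y > 0" "\<beta> \<ge> 0" "\<gamma> \<ge> 0" "finite F"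
    and nonpos: "\<And>v. v > 0 \<Longrightarrow> v \<notin> F \<Longrightarrow> 1 + \<beta> * real v - \<gamma> * (real v)\<^sup>2 \<le> 0"
  shows "(\<Sum>v\<in>F. real v * exp (- y * real v) * (1 + \<beta> * real v - \<gamma> * (real v)\<^sup>2))
    \<ge> 1 / (exp (y / 2) - exp (- y / 2))\<^sup>2 + \<beta> * (\<Sum>v\<le>V. (real v)\<^sup>2 * exp (- y * real v)) - \<gamma> * (64 / y ^ 4)"
    (is "?L \<ge> ?S + ?G - ?E")
proof -
  define T where "T = (\<lambda>v. real v * exp (- y * real v) * (1 + \<beta> * real v - \<gamma> * (real v)\<^sup>2))"
  obtain K where K: "F \<subseteq> {..<K}" using assms(4) finite_nat_iff_bounded by auto
  \<comment> \<open>The limit is taken only in the series with a known closed form: the gain from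
    \<beta> is cut off at \<open>V\<close>, and the loss from \<gamma> is bounded uniformly in
    \<open>W\<close>.\<close>
  have "(\<Sum>v<W. real v * exp (- y * real v)) \<le> ?L - ?G + ?E" if W: "W \<ge> max K (Suc V)" for W
  proof -
    have FW: "F \<subseteq> {..<W}" using K W by auto
    have "(\<Sum>v<W. T v) = (\<Sum>v\<in>F. T v) + (\<Sum>v\<in>{..<W} - F. T v)"
      using FW by (subst sum.subset_diff[of F]) auto
    also have "(\<Sum>v\<in>{..<W} - F. T v) \<le> 0"
    proof (rule sum_nonpos)
      fix v assume "v \<in> {..<W} - F"
      then show "T v \<le> 0"
        using nonpos[of v] by (cases "v = 0") (auto simp: T_def intro!: mult_nonneg_nonpos)
    qed
    finally have "(\<Sum>v<W. T v) \<le> ?L" by (simp add: T_def)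
    moreover have "(\<Sum>v<W. T v) = (\<Sum>v<W. real v * exp (- y * real v))
        + \<beta> * (\<Sum>v<W. (real v)\<^sup>2 * exp (- y * real v)) - \<gamma> * (\<Sum>v<W. real v ^ 3 * exp (- y * real v))"
      unfolding sum_distrib_left sum.distrib[symmetric] sum_subtractf[symmetric]
      by (intro sum.cong refl) (simp add: T_def algebra_simps power2_eq_square power3_eq_cube)
    moreover have "\<gamma> * (\<Sum>v<W. real v ^ 3 * exp (- y * real v)) \<le> ?E"
      using assms by (intro mult_left_mono sum_cube_exp_le) auto
    moreover have "?G \<le> \<beta> * (\<Sum>v<W. (real v)\<^sup>2 * exp (- y * real v))"
      using assms W by (intro mult_left_mono sum_mono2) auto
    ultimately show ?thesis by linarith
  qed
  moreover have "(\<lambda>W. \<Sum>v<W. real v * exp (- y * real v)) \<longlonglongrightarrow> ?S"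
    using sums_nat_times_exp[OF assms(1)] by (simp add: sums_def)
  ultimately have "?S \<le> ?L - ?G + ?E"
    by (intro LIMSEQ_le_const2) blast+
  then show ?thesis by simp
qed

text \<open>
  Induction on the recurrence with \<open>f x = \<delta> x\<^sup>-\<^sup>B exp (c \<surd>x)\<close>, \<open>s = c/(2 \<surd>n)\<close>: the main term of
  the double sum is exactly \<open>n f n\<close>, and each error is a multiple of \<open>f n / s\<close>. The factor \<open>x\<^sup>-\<^sup>B\<close>
  contributes a gain of \<open>B/(6 e c\<^sup>2 s) f n\<close>, and \<open>B\<close> is chosen to beat the total loss
  \<open>(64 + 2 + 1)/s f n\<close>. Only \<open>k \<le> 1/s\<close> is needed.
\<close>
lemma num_parts_lower_bound:
  obtains \<delta> B :: real where "\<delta> > 0" "B \<ge> 0"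
    "\<And>n. n \<ge> 1 \<Longrightarrow> real (num_parts n) \<ge> \<delta> * real n powr (-B) * exp (pi * sqrt (2 / 3) * sqrt (real n))"
proof -
  define c where "c = pi * sqrt (2 / 3)"
  have c: "c > 0" by (simp add: c_def)
  have c2: "c\<^sup>2 = 2 * pi\<^sup>2 / 3" by (simp add: c_def power_mult_distrib)
  \<comment> \<open>\<open>402 = 6 * 67\<close>, so that the gain is at least
    \<open>67/s\<close>.\<close>
  define B where "B = 402 * exp 1 * c\<^sup>2"
  have B: "B > 0" using c by (simp add: B_def)
  \<comment> \<open>For \<open>r \<ge> R\<close>, \<open>c \<le> r\<close> gives
    \<open>s \<le> 1/2\<close>, and \<open>1 + B \<le> c/2 * r\<close> makes the factors outside
    \<open>F\<close> nonpositive.\<close>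
  define R where "R = max c (2 * (1 + B) / c)"
  \<comment> \<open>This makes \<open>f n \<le> 1\<close> for \<open>sqrt n < R\<close>, which
    starts the induction.\<close>
  define \<delta> where "\<delta> = exp (- c * R)"
  define f where "f = (\<lambda>x. \<delta> * x powr (-B) * exp (c * sqrt x))"
  have f_pos: "x > 0 \<Longrightarrow> f x > 0" for x by (simp add: f_def \<delta>_def)
  have main: "real (num_parts n) \<ge> f (real n)" if "n \<ge> 1" for n
    using that
  proof (induction n rule: less_induct)
    case (less n)
    define r where "r = sqrt (real n)"
    have r: "r \<ge> 1" "real n = r\<^sup>2" using less.prems by (auto simp: r_def)
    show ?case
    proof (cases "r < R")
      case True
      have "f (real n) \<le> \<delta> * 1 * exp (c * R)"
        unfolding f_def using True less.prems c B
        by (intro mult_mono mult_nonneg_nonneg) (auto simp: \<delta>_def r_def powr_minus field_simps ge_one_powr_ge_zero)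
      also have "\<dots> = 1" by (simp add: \<delta>_def exp_add[symmetric])
      also have "\<dots> \<le> real (num_parts n)" using num_parts_ge_1[of n] by simp
      finally show ?thesis .
    next
      case False
      then have "c \<le> r" "2 * (1 + B) / c \<le> r" by (auto simp: R_def)
      then have rR: "c \<le> r" "1 + B \<le> c / 2 * r" using c by (simp_all add: field_simps)
      define s where "s = c / (2 * r)"
      have s: "s > 0" "s \<le> 1 / 2" using c rR r by (auto simp: s_def field_simps)
      \<comment> \<open>\<open>D * x^2\<close> is \<open>c\<close> times the quadratic error term in
        \<open>sqrt_diff_ge\<close>.\<close>
      define D where "D = c / (2 * r ^ 3)"
      have D: "D > 0" using c r by (simp add: D_def)
      \<comment> \<open>Relative to \<open>n powr (-B)\<close>, the power of \<open>n - x\<close>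
        gains at least the factor \<open>exp (B * x / n)\<close>; \<open>exp z \<ge> 1 + z\<close>
        then makes gain and loss additive.\<close>
      have f_shift: "f (real n - x) \<ge> f (real n) * (exp (- s * x) * (1 + B / real n * x - D * x\<^sup>2))"
        if x: "0 \<le> x" "x < real n" for x
      proof -
        have n: "real n > 0" using less.prems by simp
        have "(real n - x) powr (-B) = real n powr (-B) * (1 - x / real n) powr (-B)"
        proof -
          have "real n - x = real n * (1 - x / real n)" using n by (simp add: field_simps)
          then show ?thesis using x n by (simp only: powr_mult)
        qed
        moreover have "(1 - x / real n) powr (-B) \<ge> exp (B * (x / real n))"
        proof -
          have "ln (1 - x / real n) \<le> - (x / real n)"
            using ln_le_minus_one[of "1 - x / real n"] x n by (simp add: field_simps)
          then have "B * ln (1 - x / real n) \<le> B * - (x / real n)" using B by (intro mult_left_mono) auto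
          then show ?thesis using x n by (simp add: powr_def)
        qed
        ultimately have 1: "(real n - x) powr (-B) \<ge> real n powr (-B) * exp (B * (x / real n))"
          by (simp add: mult_left_mono)
        have "c * sqrt (real n - x) \<ge> c * (r - x / (2 * r) - x\<^sup>2 / (2 * r ^ 3))"
          using sqrt_diff_ge[of "real n" x] x n c by (intro mult_left_mono) (auto simp: r_def)
        then have 2: "exp (c * sqrt (real n - x)) \<ge> exp (c * r - s * x - D * x\<^sup>2)"
          by (simp add: s_def D_def field_simps)
        have "f (real n - x) \<ge> \<delta> * (real n powr (-B) * exp (B * (x / real n))) * exp (c * r - s * x - D * x\<^sup>2)"
          unfolding f_def using 1 2 by (intro mult_mono mult_left_mono) (auto simp: \<delta>_def)
        also have "\<delta> * (real n powr (-B) * exp (B * (x / real n))) * exp (c * r - s * x - D * x\<^sup>2)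
            = f (real n) * (exp (- s * x) * exp (B / real n * x - D * x\<^sup>2))"
          by (simp add: f_def r_def exp_add exp_diff exp_minus field_simps)
        also have "\<dots> \<ge> f (real n) * (exp (- s * x) * (1 + B / real n * x - D * x\<^sup>2))"
          using f_pos[OF n] exp_ge_add_one_self[of "B / real n * x - D * x\<^sup>2"]
          by (intro mult_left_mono) (auto simp: algebra_simps)
        finally show ?thesis .
      qed
      \<comment> \<open>\<open>k \<le> 1/s\<close> keeps \<open>y = s * k\<close> at most 1, as
        \<open>nat_times_exp_ge\<close> requires, while the discarded tail of \<open>1/k^2\<close>
        is at most \<open>1/M \<le> 2 * s\<close>.\<close>
      define M where "M = nat \<lfloor>1 / s\<rfloor>"
      have M: "real M \<le> 1 / s" "real M \<ge> 1 / (2 * s)" "M \<ge> 1"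
      proof -
        have "1 / s \<ge> 2" using s by (simp add: field_simps)
        then have "real M = of_int \<lfloor>1 / s\<rfloor>" unfolding M_def by (subst of_nat_nat) linarith+
        then have "real M > 1 / s - 1" "real M \<le> 1 / s" by linarith+
        moreover have "1 / (2 * s) = 1 / s / 2" by simp
        ultimately show "real M \<le> 1 / s" "real M \<ge> 1 / (2 * s)" "M \<ge> 1"
          using \<open>1 / s \<ge> 2\<close> by linarith+
      qed
      define G where "G = (\<Sum>v\<le>M. (real v)\<^sup>2 * exp (- s * real v))"
      \<comment> \<open>The inequality is strict so that \<open>n - k * v \<ge> 1\<close>, where the
        induction hypothesis applies.\<close>
      define F where "F = (\<lambda>k. {v. 1 \<le> v \<and> k * v < n})"
      have finF: "finite (F k)" if "k \<ge> 1" for k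
      proof (rule finite_subset)
        show "F k \<subseteq> {..n}" using that unfolding F_def
          by (auto elim!: order_trans[rotated] dest!: less_imp_le)
      qed simp
      \<comment> \<open>The gain from \<open>B\<close> is kept only for \<open>k = 1\<close>, the
        losses for every \<open>k\<close>.\<close>
      have inner: "(\<Sum>v\<in>F k. real v * f (real n - real (k * v)))
          \<ge> f (real n) * (1 / (real k * s)\<^sup>2 - 1 + (if k = 1 then B / real n * G else 0) - D * (64 / s ^ 4) * (1 / real k ^ 2))"
        if k: "k \<in> {1..M}" for k
      proof -
        define y where "y = s * real k"
        have y: "y > 0" "y \<le> 1"
        proof -
          have "real k \<le> 1 / s" using M k by (auto intro: order_trans)
          then show "y > 0" "y \<le> 1" using s k by (auto simp: y_def field_simps)
        qed
        let ?\<beta> = "B / real n * real k" and ?\<gamma> = "D * (real k)\<^sup>2"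
        have "1 / (real k * s)\<^sup>2 - 1 + (if k = 1 then B / real n * G else 0) - D * (64 / s ^ 4) * (1 / real k ^ 2)
          \<le> 1 / (exp (y / 2) - exp (- y / 2))\<^sup>2 + ?\<beta> * (\<Sum>v\<le>M. (real v)\<^sup>2 * exp (- y * real v)) - ?\<gamma> * (64 / y ^ 4)"
        proof (intro add_mono diff_mono)
          show "1 / (real k * s)\<^sup>2 - 1 \<le> 1 / (exp (y / 2) - exp (- y / 2))\<^sup>2"
            using nat_times_exp_ge[OF y] by (simp add: y_def mult.commute)
          show "(if k = 1 then B / real n * G else 0) \<le> ?\<beta> * (\<Sum>v\<le>M. (real v)\<^sup>2 * exp (- y * real v))"
            using B by (auto simp: G_def y_def intro!: mult_nonneg_nonneg divide_nonneg_nonneg sum_nonneg)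
          show "?\<gamma> * (64 / y ^ 4) \<le> D * (64 / s ^ 4) * (1 / real k ^ 2)"
            using k s by (simp add: y_def power_mult_distrib power2_eq_square power4_eq_xxxx mult_ac)
        qed
        also have "\<dots> \<le> (\<Sum>v\<in>F k. real v * exp (- y * real v) * (1 + ?\<beta> * real v - ?\<gamma> * (real v)\<^sup>2))"
        proof (rule truncated_sum_ge)
          fix v :: nat assume v: "v > 0" "v \<notin> F k"
          \<comment> \<open>Outside \<open>F k\<close>, \<open>u \<ge> 1\<close>, hence the loss
            \<open>c/2 * r * u^2\<close> is at least \<open>(1 + B) * u\<close>.\<close>
          define u where "u = real (k * v) / real n"
          have u: "u \<ge> 1" using v less.prems unfolding u_def F_def
            by (auto simp: not_less simp flip: of_nat_mult)
          have kv: "real k * real v = u * r\<^sup>2" using r less.prems by (simp add: u_def field_simps)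
          have "1 + ?\<beta> * real v - ?\<gamma> * (real v)\<^sup>2 = 1 + B * u - c / 2 * r * (u * u)"
          proof -
            have "?\<beta> * real v = B / real n * (real k * real v)" by simp
            also have "\<dots> = B * u" using r(1) unfolding kv r(2) by simp
            finally have 1: "?\<beta> * real v = B * u" .
            have "?\<gamma> * (real v)\<^sup>2 = D * (real k * real v)\<^sup>2" by (simp add: power_mult_distrib)
            also have "\<dots> = c / 2 * r * (u * u)"
              using r(1) unfolding kv by (simp add: D_def power2_eq_square power3_eq_cube)
            finally show ?thesis by (simp only: 1)
          qed
          also have "\<dots> \<le> u + B * u - c / 2 * r * (u * 1)"
            using u c r(1) B by (intro diff_mono add_mono mult_left_mono) auto
          also have "\<dots> = u * (1 + B - c / 2 * r)" by (simp add: algebra_simps)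
          also have "\<dots> \<le> 0" using u rR by (intro mult_nonneg_nonpos) auto
          finally show "1 + ?\<beta> * real v - ?\<gamma> * (real v)\<^sup>2 \<le> 0" .
        qed (use y B D finF k in auto)
        finally have "f (real n) * (1 / (real k * s)\<^sup>2 - 1 + (if k = 1 then B / real n * G else 0) - D * (64 / s ^ 4) * (1 / real k ^ 2))
          \<le> f (real n) * (\<Sum>v\<in>F k. real v * exp (- y * real v) * (1 + ?\<beta> * real v - ?\<gamma> * (real v)\<^sup>2))"
          using f_pos[of "real n"] less.prems by (intro mult_left_mono) auto
        also have "\<dots> = (\<Sum>v\<in>F k. real v * (f (real n) * (exp (- s * (k * v)) * (1 + B / real n * (k * v) - D * (real (k * v))\<^sup>2))))"
          unfolding sum_distrib_left y_def by (intro sum.cong refl) (simp add: power_mult_distrib mult_ac)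
        also have "\<dots> \<le> (\<Sum>v\<in>F k. real v * f (real n - real (k * v)))"
          by (intro sum_mono mult_left_mono f_shift) (auto simp: F_def simp flip: of_nat_mult)
        finally show ?thesis .
      qed
      \<comment> \<open>On \<open>v \<le> M \<le> 1/s\<close> the exponential is at least
        \<open>exp (-1)\<close>, and the squares sum to at least \<open>M^3 / 3\<close>.\<close>
      have G: "G \<ge> 1 / (24 * exp 1 * s ^ 3)"
      proof -
        have "1 / (24 * exp 1 * s ^ 3) = exp (-1) * ((1 / (2 * s)) ^ 3 / 3)"
          using s by (simp add: exp_minus power_divide field_simps power_mult_distrib)
        also have "\<dots> \<le> exp (-1) * (real M ^ 3 / 3)"
          using M s by (intro mult_left_mono divide_right_mono power_mono) auto
        also have "\<dots> \<le> exp (-1) * (\<Sum>v\<le>M. (real v)\<^sup>2)"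
          by (intro mult_left_mono sum_squares_ge) auto
        also have "\<dots> \<le> G"
          unfolding G_def sum_distrib_left
        proof (intro sum_mono)
          fix v assume "v \<in> {..M}"
          then have "real v \<le> 1 / s" using M by (auto intro: order_trans)
          then have "s * real v \<le> 1" using s by (simp add: field_simps)
          then show "exp (-1) * (real v)\<^sup>2 \<le> (real v)\<^sup>2 * exp (- s * real v)"
            by (subst mult.commute) (rule mult_left_mono, auto)
        qed
        finally show ?thesis .
      qed
      have n_s: "real n = pi\<^sup>2 / 6 / s\<^sup>2"
        using c2 c r(1) by (simp add: s_def r(2) power_divide power_mult_distrib field_simps)
      \<comment> \<open>The losses are \<open>2/s\<close> from the tail of \<open>1/k^2\<close>,
        \<open>M \<le> 1/s\<close> from the additive 1 for each \<open>k\<close>, and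
        \<open>64/s\<close> from \<open>D\<close>; the gain \<open>67/s\<close> covers them.\<close>
      have "real n \<le> (\<Sum>k=1..M. 1 / (real k * s)\<^sup>2 - 1 + (if k = 1 then B / real n * G else 0) - D * (64 / s ^ 4) * (1 / real k ^ 2))"
      proof -
        let ?Z = "\<Sum>k=1..M. 1 / real k ^ 2"
        have "(\<Sum>k=1..M. 1 / (real k * s)\<^sup>2 - 1 + (if k = 1 then B / real n * G else 0) - D * (64 / s ^ 4) * (1 / real k ^ 2))
          = ?Z / s\<^sup>2 - real M + B / real n * G - D * (64 / s ^ 4) * ?Z"
          using M(3) by (simp add: sum.distrib sum_subtractf sum_distrib_left sum_divide_distrib power_mult_distrib)
        moreover have "?Z / s\<^sup>2 \<ge> real n - 2 / s"
        proof -
          have "(pi\<^sup>2 / 6 - 1 / real M) / s\<^sup>2 \<le> ?Z / s\<^sup>2"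
            by (intro divide_right_mono sum_inverse_squares_ge M) auto
          moreover have "1 / real M \<le> 2 * s" using M s by (simp add: field_simps)
          then have "1 / real M / s\<^sup>2 \<le> 2 * s / s\<^sup>2" by (intro divide_right_mono) auto
          ultimately show ?thesis using s by (simp add: n_s diff_divide_distrib power2_eq_square)
        qed
        moreover have "D * (64 / s ^ 4) * ?Z \<le> 64 / s"
        proof -
          have "D * (64 / s ^ 4) * ?Z \<le> D * (64 / s ^ 4) * (pi\<^sup>2 / 6)"
            using D by (intro mult_left_mono sum_inverse_squares_le) auto
          also have "pi\<^sup>2 / 6 = c\<^sup>2 / 4" using c2 by simp
          also have "D * (64 / s ^ 4) * (c\<^sup>2 / 4) = 64 / s"
          proof -
            have "D = 4 * s ^ 3 / c\<^sup>2" using c r(1) by (simp add: D_def s_def power2_eq_square power3_eq_cube field_simps)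
            then show ?thesis
              using s c by (simp add: power2_eq_square power3_eq_cube power4_eq_xxxx)
          qed
          finally show ?thesis .
        qed
        moreover have "B / real n * G \<ge> 67 / s"
        proof -
          have "67 / s = B / real n * (1 / (24 * exp 1 * s ^ 3))"
          proof -
            have "real n = c\<^sup>2 / 4 / s\<^sup>2" unfolding n_s c2 by simp
            then show ?thesis using s c by (simp add: B_def power2_eq_square power3_eq_cube field_simps)
          qed
          also have "\<dots> \<le> B / real n * G" using B G by (intro mult_left_mono) auto
          finally show ?thesis .
        qed
        moreover have "67 / s = 64 / s + 2 / s + 1 / s" using s by (simp add: field_simps)
        ultimately show ?thesis using M(1) by linarith
      qed
      then have "real n * f (real n) \<le> (\<Sum>k=1..M. 1 / (real k * s)\<^sup>2 - 1 + (if k = 1 then B / real n * G else 0) - D * (64 / s ^ 4) * (1 / real k ^ 2)) * f (real n)"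
        using f_pos[of "real n"] less.prems by (intro mult_right_mono) auto
      also have "\<dots> = (\<Sum>k=1..M. f (real n) * (1 / (real k * s)\<^sup>2 - 1 + (if k = 1 then B / real n * G else 0) - D * (64 / s ^ 4) * (1 / real k ^ 2)))"
        unfolding sum_distrib_right by (intro sum.cong refl mult.commute)
      also have "\<dots> \<le> (\<Sum>k=1..M. \<Sum>v\<in>F k. real v * f (real n - real (k * v)))"
        by (intro sum_mono inner)
      also have "\<dots> \<le> (\<Sum>k=1..M. \<Sum>v\<in>F k. real v * real (num_parts (n - k * v)))"
      proof (intro sum_mono mult_left_mono)
        fix k v assume "k \<in> {1..M}" "v \<in> F k"
        then have "n - k * v < n" "n - k * v \<ge> 1" "k * v < n" by (auto simp: F_def)
        with less.IH[of "n - k * v"] show "f (real n - real (k * v)) \<le> real (num_parts (n - k * v))"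
          by (simp add: of_nat_diff)
      qed auto
      also have "\<dots> = (\<Sum>(k, v)\<in>(SIGMA k:{1..M}. F k). real v * real (num_parts (n - k * v)))"
        using finF by (subst sum.Sigma) auto
      \<comment> \<open>The recurrence lists parts first and repetitions second; after the swap the
        terms form a subset of its nonnegative terms.\<close>
      also have "\<dots> = (\<Sum>(v, k)\<in>prod.swap ` (SIGMA k:{1..M}. F k). real v * real (num_parts (n - k * v)))"
        by (subst sum.reindex) (auto simp: case_prod_unfold)
      also have "\<dots> \<le> (\<Sum>(v, k)\<in>(SIGMA v:{v \<in> {1..}. v \<le> n}. {k. 1 \<le> k \<and> k * v \<le> n}). real v * real (num_parts (n - k * v)))"
      proof (rule sum_mono2)
        show "finite (SIGMA v:{v \<in> {1..}. v \<le> n}. {k. 1 \<le> k \<and> k * v \<le> n})"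
        proof (rule finite_subset)
          have "k \<le> n" if "k * v \<le> n" "v \<ge> 1" for k v :: nat
            using mult_le_mono2[OF that(2), of k] that(1) by linarith
          then show "(SIGMA v:{v \<in> {1..}. v \<le> n}. {k. 1 \<le> k \<and> k * v \<le> n}) \<subseteq> {..n} \<times> {..n}"
            by auto
        qed simp
        show "prod.swap ` (SIGMA k:{1..M}. F k) \<subseteq> (SIGMA v:{v \<in> {1..}. v \<le> n}. {k. 1 \<le> k \<and> k * v \<le> n})"
        proof -
          have "v \<le> n" if "k * v < n" "k \<ge> 1" for k v :: nat
            using mult_le_mono1[OF that(2), of v] that(1) by linarith
          then show ?thesis by (auto simp: F_def)
        qed
      qed auto
      also have "\<dots> = real (n * num_parts n)"
      proof -
        have "finite {k. 1 \<le> k \<and> k * v \<le> n}" if "v \<in> {v \<in> {1..}. v \<le> n}" for v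
        proof (rule finite_subset)
          show "{k. 1 \<le> k \<and> k * v \<le> n} \<subseteq> {..n}"
          proof (clarsimp)
            fix k assume "k * v \<le> n"
            moreover have "k * 1 \<le> k * v" using that by (intro mult_le_mono2) simp
            ultimately show "k \<le> n" by linarith
          qed
        qed simp
        then have "(\<Sum>(v, k)\<in>(SIGMA v:{v \<in> {1..}. v \<le> n}. {k. 1 \<le> k \<and> k * v \<le> n}). real v * real (num_parts (n - k * v)))
          = (\<Sum>v | v \<in> {1..} \<and> v \<le> n. \<Sum>k | 1 \<le> k \<and> k * v \<le> n. real v * real (num_parts (n - k * v)))"
          using parts.finite_weight_le[of n] by (intro sum.Sigma[symmetric]) auto
        then show ?thesis
          by (subst parts.num_weighted_recurrence) (simp only: of_nat_sum of_nat_mult)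
      qed
      finally show ?thesis using less.prems by simp
    qed
  qed
  show ?thesis
    by (rule that[of \<delta> B]) (use B main in \<open>auto simp: f_def c_def \<delta>_def\<close>)
qed

section \<open>Partitions into parts of bounded size\<close>

text \<open>Parts exceed \<open>m\<close> so that in a block with sides \<open>a \<le> m\<close> and
  \<open>b\<close> the part \<open>b\<close> can be recognized; the cap \<open>K\<close> limits the
  space lost when filling rows. The sum is only bounded by \<open>N\<close> because the parts up to
  \<open>m\<close> of a partition of \<open>N\<close> are discarded.\<close>

definition long_parts :: "nat \<Rightarrow> nat \<Rightarrow> nat \<Rightarrow> nat multiset set" where
  "long_parts m K N = {X. set_mset X \<subseteq> {m<..K} \<and> sum_mset X \<le> N}"

lemma finite_long_parts: "finite (long_parts m K N)"
proof (rule finite_subset)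
  show "long_parts m K N \<subseteq> (\<Union>n\<le>N. weighted_msets (\<lambda>x. x) {1..} n)"
    by (fastforce simp: long_parts_def weighted_msets_def)
qed (use parts.finite_weighted_msets in auto)

text \<open>Remove one part \<open>j > K\<close>: there are at most \<open>N\<close> choices of
  \<open>j\<close>, and \<open>num_parts_le\<close> with the tangent bound limits the partitions of
  \<open>N - j\<close>.\<close>

lemma card_large_part_le:
  assumes "N \<ge> 1"
  shows "real (card {X \<in> weighted_msets (\<lambda>x. x) {1..} N. \<not> set_mset X \<subseteq> {..K}})
    \<le> real N * exp (pi * sqrt (2 / 3) * (sqrt (real N) - real K / (2 * sqrt (real N))))"
    (is "real (card ?B) \<le> _")
proof -
  let ?W = "weighted_msets (\<lambda>x. x) {1..}"
  have "?B \<subseteq> (\<Union>j\<in>{K<..N}. add_mset j ` ?W (N - j))"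
  proof
    fix X assume X: "X \<in> ?B"
    then obtain j where "j \<in># X" "\<not> j \<le> K" by auto
    then have j: "j \<in># X" "K < j" by auto
    have "j \<le> N" using member_le_weight[OF j(1), of "\<lambda>x. x"] X by (simp add: weighted_msets_def)
    moreover have "X = add_mset j (X - {#j#})" using j by simp
    moreover have "X - {#j#} \<in> ?W (N - j)"
      using X j by (auto simp: weighted_msets_def sum_mset_diff dest: in_diffD)
    ultimately show "X \<in> (\<Union>j\<in>{K<..N}. add_mset j ` ?W (N - j))"
      using j(2) by (intro UN_I[of j] image_eqI[of _ _ "X - {#j#}"]) auto
  qed
  then have "card ?B \<le> card (\<Union>j\<in>{K<..N}. add_mset j ` ?W (N - j))"
    by (intro card_mono finite_UN_I finite_imageI parts.finite_weighted_msets) simp_all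
  also have "\<dots> \<le> (\<Sum>j\<in>{K<..N}. card (add_mset j ` ?W (N - j)))"
    by (rule card_UN_le) simp
  also have "\<dots> \<le> (\<Sum>j\<in>{K<..N}. num_parts (N - j))"
    unfolding num_weighted_def by (intro sum_mono card_image_le parts.finite_weighted_msets)
  finally have "real (card ?B) \<le> (\<Sum>j\<in>{K<..N}. real (num_parts (N - j)))"
    by (simp flip: of_nat_sum)
  also have "\<dots> \<le> (\<Sum>j\<in>{K<..N}. exp (pi * sqrt (2 / 3) * (sqrt (real N) - real K / (2 * sqrt (real N)))))"
  proof (intro sum_mono)
    fix j assume j: "j \<in> {K<..N}"
    have "sqrt (real (N - j)) \<le> sqrt (real N) - real j / (2 * sqrt (real N))"
      using sqrt_diff_le[of "real N" "real j"] j by (simp add: of_nat_diff)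
    also have "\<dots> \<le> sqrt (real N) - real K / (2 * sqrt (real N))"
      using j by (intro diff_mono divide_right_mono) auto
    finally have "exp (pi * sqrt (2 / 3) * sqrt (real (N - j))) \<le> exp (pi * sqrt (2 / 3) * (sqrt (real N) - real K / (2 * sqrt (real N))))"
      by (simp add: mult_left_mono)
    then show "real (num_parts (N - j)) \<le> exp (pi * sqrt (2 / 3) * (sqrt (real N) - real K / (2 * sqrt (real N))))"
      using num_parts_le[of "N - j"] by linarith
  qed
  also have "\<dots> \<le> real N * exp (pi * sqrt (2 / 3) * (sqrt (real N) - real K / (2 * sqrt (real N))))"
    by (simp add: mult_right_mono)
  finally show ?thesis .
qed

text \<open>A partition is determined by its parts beyond \<open>m\<close> and the multiplicities of
  \<open>1..m\<close>, each of which is at most \<open>N\<close>.\<close>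

lemma card_bounded_parts_le:
  "card {X \<in> weighted_msets (\<lambda>x. x) {1..} N. set_mset X \<subseteq> {..K}} \<le> card (long_parts m K N) * (N + 1) ^ m"
    (is "card ?G \<le> _")
proof -
  let ?f = "\<lambda>X. (filter_mset (\<lambda>x. m < x) X, restrict (count X) {1..m})"
  let ?T = "long_parts m K N \<times> ({1..m} \<rightarrow>\<^sub>E {..N})"
  have "card ?G \<le> card ?T"
  proof (rule card_inj_on_le)
    show "inj_on ?f ?G"
    proof (rule inj_onI, rule multiset_eqI)
      fix X Y x assume XY: "X \<in> ?G" "Y \<in> ?G" "?f X = ?f Y"
      then have "0 \<notin># X" "0 \<notin># Y" by (auto simp: weighted_msets_def)
      moreover have "count X x = count Y x" if "m < x"
        using XY(3) that by (metis count_filter_mset fst_conv)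
      moreover have "count X x = count Y x" if "x \<in> {1..m}"
        using XY(3) that by (metis restrict_apply' snd_conv)
      ultimately show "count X x = count Y x"
        by (cases "x = 0"; cases "m < x") (simp_all add: not_in_iff)
    qed
    show "?f ` ?G \<subseteq> ?T"
    proof (rule image_subsetI)
      fix X assume X: "X \<in> ?G"
      have "sum_mset (filter_mset (\<lambda>x. m < x) X) \<le> sum_mset X"
        by (metis multiset_partition le_add1 sum_mset.union)
      moreover have "count X x \<le> N" for x
        using X parts.size_le_weight[of X] count_le_size[of X x] by (simp add: weighted_msets_def)
      ultimately show "?f X \<in> ?T"
        using X by (auto simp: long_parts_def weighted_msets_def PiE_iff)
    qed
    show "finite ?T" by (intro finite_cartesian_product finite_long_parts finite_PiE) auto
  qed
  also have "\<dots> = card (long_parts m K N) * (N + 1) ^ m"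
    by (simp add: card_cartesian_product card_PiE)
  finally show ?thesis .
qed

text \<open>\<open>M\<close> is a common bound for all values of \<open>N\<close> used later, so the
  polynomial loss and the threshold for \<open>K\<close> do not depend on \<open>N\<close>.\<close>

lemma long_parts_lower_bound:
  fixes m :: nat
  obtains \<delta> B \<kappa> :: real where "\<delta> > 0" "B \<ge> 0" "\<kappa> \<ge> 0"
    "\<And>M N K :: nat. M \<ge> 2 \<Longrightarrow> 1 \<le> N \<Longrightarrow> N \<le> M \<Longrightarrow> real K \<ge> \<kappa> * sqrt (real M) * ln (real M) \<Longrightarrow>
       real (card (long_parts m K N)) \<ge> \<delta> * real M powr (-B) * exp (pi * sqrt (2 / 3) * sqrt (real N))"
proof -
  define c where "c = pi * sqrt (2 / 3)"
  have c: "c > 0" by (simp add: c_def)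
  obtain \<delta> B :: real where \<delta>: "\<delta> > 0" and B: "B \<ge> 0" and lower:
    "\<And>n. n \<ge> 1 \<Longrightarrow> real (num_parts n) \<ge> \<delta> * real n powr (-B) * exp (c * sqrt (real n))"
    using num_parts_lower_bound unfolding c_def by metis
  \<comment> \<open>With this \<open>t\<close>, \<open>M powr (- t) \<le> \<delta>/2\<close> for
    every \<open>M \<ge> 2\<close>.\<close>
  define t where "t = \<bar>ln (2 / \<delta>)\<bar> / ln 2"
  have t: "t \<ge> 0" by (simp add: t_def)
  \<comment> \<open>A part above \<open>K\<close> then costs a factor
    \<open>M powr (- (1 + B + t))\<close>. This pays for the factor \<open>N\<close>, for
    \<open>M powr (-B)\<close> and for \<open>\<delta>/2\<close>, so half of the lower bound
    survives.\<close>
  define \<kappa> where "\<kappa> = 2 * (1 + B + t) / c"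
  have \<kappa>: "\<kappa> \<ge> 0" using t B c by (simp add: \<kappa>_def)
  show ?thesis
  proof (rule that[of "\<delta> / 2" "B + 2 * real m" \<kappa>])
    fix M N K :: nat
    assume M: "M \<ge> 2" and N: "1 \<le> N" "N \<le> M" and K: "real K \<ge> \<kappa> * sqrt (real M) * ln (real M)"
    define E where "E = exp (c * sqrt (real N))"
    let ?W = "weighted_msets (\<lambda>x. x) {1..} N"
    let ?B = "{X \<in> ?W. \<not> set_mset X \<subseteq> {..K}}" and ?G = "{X \<in> ?W. set_mset X \<subseteq> {..K}}"
    have "num_parts N = card ?G + card ?B"
    proof -
      have fin: "finite ?G" "finite ?B"
        by (rule finite_subset[OF _ parts.finite_weighted_msets[of N]], rule Collect_restrict)+
      have "?G \<inter> ?B = {}" "?G \<union> ?B = ?W" by (intro set_eqI iffI; simp; fast)+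
      then show ?thesis
        using card_Un_disjoint[OF fin] by (simp only: num_weighted_def)
    qed
    moreover have "real (num_parts N) \<ge> \<delta> * real M powr (-B) * E"
    proof -
      have "real M powr (-B) \<le> real N powr (-B)"
        using N B by (intro powr_mono2') auto
      then have "\<delta> * real M powr (-B) * E \<le> \<delta> * real N powr (-B) * E"
        using \<delta> by (intro mult_right_mono mult_left_mono) (auto simp: E_def)
      then show ?thesis using lower[OF N(1)] by (simp add: E_def)
    qed
    moreover have "real (card ?B) \<le> \<delta> / 2 * real M powr (-B) * E"
    proof -
      have "real (card ?B) \<le> real N * exp (c * (sqrt (real N) - real K / (2 * sqrt (real N))))"
        using card_large_part_le[OF N(1), of K] by (simp add: c_def)
      also have "\<dots> = real N * (E * exp (- (c * (real K / (2 * sqrt (real N))))))"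
        by (simp add: E_def exp_add[symmetric] algebra_simps)
      also have "\<dots> \<le> real M * (E * exp (- ((1 + B + t) * ln (real M))))"
      proof (intro mult_mono mult_left_mono)
        have "(1 + B + t) * ln (real M) = c * (\<kappa> * sqrt (real M) * ln (real M) / (2 * sqrt (real M)))"
          using c M by (simp add: \<kappa>_def)
        also have "\<dots> \<le> c * (real K / (2 * sqrt (real M)))"
          using c K by (intro mult_left_mono divide_right_mono) auto
        also have "\<dots> \<le> c * (real K / (2 * sqrt (real N)))"
          using c N by (intro mult_left_mono divide_left_mono) auto
        finally show "exp (- (c * (real K / (2 * sqrt (real N))))) \<le> exp (- ((1 + B + t) * ln (real M)))"
          by simp
      qed (use N in \<open>auto simp: E_def\<close>)
      also have "\<dots> = real M powr (-B) * E * exp (- (t * ln (real M)))"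
      proof -
        have "exp (- ((1 + B + t) * ln (real M))) = exp (- ln (real M) + (- B * ln (real M) + - (t * ln (real M))))"
          by (simp add: algebra_simps)
        also have "\<dots> = 1 / real M * (real M powr (-B) * exp (- (t * ln (real M))))"
          using M unfolding exp_add by (simp add: powr_def exp_minus inverse_eq_divide)
        finally show ?thesis using M by simp
      qed
      also have "\<dots> \<le> real M powr (-B) * E * (\<delta> / 2)"
      proof (intro mult_left_mono)
        have "\<bar>ln (2 / \<delta>)\<bar> = t * ln 2" by (simp add: t_def)
        also have "\<dots> \<le> t * ln (real M)" using t M by (intro mult_left_mono) auto
        finally have "- (t * ln (real M)) \<le> ln (\<delta> / 2)"
          using \<delta> by (simp add: ln_div)
        then have "exp (- (t * ln (real M))) \<le> exp (ln (\<delta> / 2))" by (subst exp_le_cancel_iff)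
        then show "exp (- (t * ln (real M))) \<le> \<delta> / 2" using \<delta> by simp
      qed (auto simp: E_def)
      finally show ?thesis by (simp add: mult_ac)
    qed
    ultimately have G: "real (card ?G) \<ge> \<delta> / 2 * real M powr (-B) * E" by simp
    also have "real (card ?G) \<le> real (card (long_parts m K N) * (N + 1) ^ m)"
      using card_bounded_parts_le[of N K m] by (simp only: of_nat_le_iff)
    also have "\<dots> \<le> real (card (long_parts m K N)) * real M powr (2 * real m)"
    proof -
      have "N + 1 \<le> M * M" using M N mult_le_mono1[of 2 M M] by linarith
      then have "(N + 1) ^ m \<le> (M * M) ^ m" by (rule power_mono) simp
      then have "real ((N + 1) ^ m) \<le> real ((M * M) ^ m)" by (simp only: of_nat_le_iff)
      also have "\<dots> = real M powr (2 * real m)"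
        using M by (simp add: powr_powr[symmetric] powr_realpow power2_eq_square power_mult_distrib)
      finally show ?thesis by (simp add: mult_left_mono)
    qed
    finally have le: "\<delta> / 2 * real M powr (-B) * E \<le> real (card (long_parts m K N)) * real M powr (2 * real m)" .
    have "\<delta> / 2 * real M powr (-(B + 2 * real m)) * E = (\<delta> / 2 * real M powr (-B) * E) * real M powr (- (2 * real m))"
      by (simp add: powr_add powr_diff powr_minus field_simps)
    also have "\<dots> \<le> real (card (long_parts m K N)) * real M powr (2 * real m) * real M powr (- (2 * real m))"
      by (intro mult_right_mono le) simp
    also have "\<dots> = real (card (long_parts m K N))"
      using M by (simp add: powr_minus)
    finally show "real (card (long_parts m K N)) \<ge> \<delta> / 2 * real M powr (-(B + 2 * real m)) * exp (pi * sqrt (2 / 3) * sqrt (real N))"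
      by (simp add: E_def c_def)
  qed (use \<delta> B \<kappa> in auto)
qed

section \<open>Tilings\<close>

text \<open>The tilings obtained by repeated cuts across a whole rectangle, as certificates for
  \<open>rect_partition\<close>. Rectangles of size 0 provide the starting point for sums over
  families of strips.\<close>

inductive tiling :: "nat \<Rightarrow> nat \<Rightarrow> nat uprod multiset \<Rightarrow> bool" where
  no_width: "tiling 0 n {#}"
| no_height: "tiling m 0 {#}"
| block: "w > 0 \<Longrightarrow> h > 0 \<Longrightarrow> tiling w h {#Upair w h#}"
| beside: "tiling m1 n P \<Longrightarrow> tiling m2 n Q \<Longrightarrow> tiling (m1 + m2) n (P + Q)"
| above: "tiling m n1 P \<Longrightarrow> tiling m n2 Q \<Longrightarrow> tiling m (n1 + n2) (P + Q)"

section \<open>Gluing arrangements of rectangles\<close>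

lemma rect_translate: "rect (a + x) (b + y) w h = (+) (a, b) ` rect x y w h"
proof (intro set_eqI iffI)
  fix p assume "p \<in> rect (a + x) (b + y) w h"
  then have "p = (a, b) + (fst p - a, snd p - b)" "(fst p - a, snd p - b) \<in> rect x y w h"
    by (auto simp: rect_def prod_eq_iff)
  then show "p \<in> (+) (a, b) ` rect x y w h" by (rule image_eqI)
qed (auto simp: rect_def)

lemma interior_rect: "interior (rect x y w h) = {x<..<x + real w} \<times> {y<..<y + real h}"
  by (simp add: rect_def interior_Times)

lemma rect_partition_single:
  assumes "w > 0" "h > 0"
  shows "rect_partition w h {#Upair w h#}"
  unfolding rect_partition_def
  by (intro exI[of _ "{0}"] exI[of _ "\<lambda>_. w"] exI[of _ "\<lambda>_. h"] exI[of _ "\<lambda>_. 0"]) (use assms in auto)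

lemma rect_partition_join:
  fixes a b :: real
  assumes P: "rect_partition m1 n1 P" and Q: "rect_partition m2 n2 Q"
    and union: "rect 0 0 m1 n1 \<union> rect a b m2 n2 = rect 0 0 m n"
    and disj: "interior (rect 0 0 m1 n1) \<inter> interior (rect a b m2 n2) = {}"
  shows "rect_partition m n (P + Q)"
proof -
  obtain I :: "nat set" and w h x y where I: "finite I" "\<forall>i\<in>I. w i > 0 \<and> h i > 0"
    "P = {#Upair (w i) (h i). i \<in># mset_set I#}"
    "(\<Union>i\<in>I. rect (x i) (y i) (w i) (h i)) = rect 0 0 m1 n1"
    "\<forall>i\<in>I. \<forall>j\<in>I. i \<noteq> j \<longrightarrow>
        interior (rect (x i) (y i) (w i) (h i)) \<inter> interior (rect (x j) (y j) (w j) (h j)) = {}"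
    using P unfolding rect_partition_def by (elim exE conjE) (rule that; assumption)
  obtain I' :: "nat set" and w' h' x' y' where I': "finite I'" "\<forall>i\<in>I'. w' i > 0 \<and> h' i > 0"
    "Q = {#Upair (w' i) (h' i). i \<in># mset_set I'#}"
    "(\<Union>i\<in>I'. rect (x' i) (y' i) (w' i) (h' i)) = rect 0 0 m2 n2"
    "\<forall>i\<in>I'. \<forall>j\<in>I'. i \<noteq> j \<longrightarrow>
        interior (rect (x' i) (y' i) (w' i) (h' i)) \<inter> interior (rect (x' j) (y' j) (w' j) (h' j)) = {}"
    using Q unfolding rect_partition_def by (elim exE conjE) (rule that; assumption)
  \<comment> \<open>Even and odd indices keep the two families apart; the second one is translated
    by \<open>(a, b)\<close>.\<close>
  define ev od :: "nat \<Rightarrow> nat" where "ev = (\<lambda>i. 2 * i)" and "od = (\<lambda>i. 2 * i + 1)"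
  have inj: "inj ev" "inj od" by (auto simp: ev_def od_def inj_def)
  define J where "J = ev ` I \<union> od ` I'"
  define W H X Y where "W = (\<lambda>i. if even i then w (i div 2) else w' (i div 2))"
    and "H = (\<lambda>i. if even i then h (i div 2) else h' (i div 2))"
    and "X = (\<lambda>i. if even i then x (i div 2) else a + x' (i div 2))"
    and "Y = (\<lambda>i. if even i then y (i div 2) else b + y' (i div 2))"
  note defs = W_def H_def X_def Y_def
  define R where "R = (\<lambda>i. rect (X i) (Y i) (W i) (H i))"
  have R_ev: "R (ev i) = rect (x i) (y i) (w i) (h i)" for i
    by (simp add: R_def ev_def defs)
  have R_od: "R (od i) = (+) (a, b) ` rect (x' i) (y' i) (w' i) (h' i)" for i
    by (simp add: R_def od_def defs rect_translate)
  have tr: "rect a b m2 n2 = (+) (a, b) ` rect 0 0 m2 n2"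
    using rect_translate[of a 0 b 0] by simp
  have sub_ev: "R (ev i) \<subseteq> rect 0 0 m1 n1" if "i \<in> I" for i
    using I(4) that by (auto simp: R_ev)
  have sub_od: "R (od i) \<subseteq> rect a b m2 n2" if "i \<in> I'" for i
    using I'(4) that by (auto simp: R_od tr)
  have cross: "interior (R (ev i)) \<inter> interior (R (od j)) = {}" if "i \<in> I" "j \<in> I'" for i j
    using interior_mono[OF sub_ev[OF that(1)]] interior_mono[OF sub_od[OF that(2)]] disj by blast
  have "finite J" using I I' by (simp add: J_def)
  moreover have "\<forall>i\<in>J. W i > 0 \<and> H i > 0"
    using I(2) I'(2) by (auto simp: J_def ev_def od_def defs)
  moreover have "P + Q = {#Upair (W i) (H i). i \<in># mset_set J#}"
  proof -
    have "ev ` I \<inter> od ` I' = {}"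
    proof -
      have "ev i \<noteq> od j" for i j unfolding ev_def od_def by presburger
      then show ?thesis by auto
    qed
    then have "mset_set J = image_mset ev (mset_set I) + image_mset od (mset_set I')"
      unfolding J_def using I(1) I'(1) image_mset_mset_set[OF inj_on_subset[OF inj(1) subset_UNIV], of I]
        image_mset_mset_set[OF inj_on_subset[OF inj(2) subset_UNIV], of I']
      by (simp add: mset_set_Union)
    then show ?thesis
      by (simp add: I(3) I'(3) image_mset.compositionality comp_def ev_def od_def defs)
  qed
  moreover have "(\<Union>i\<in>J. R i) = rect 0 0 m n"
  proof -
    have "(\<Union>i\<in>J. R i) = (\<Union>i\<in>I. R (ev i)) \<union> (\<Union>i\<in>I'. R (od i))"
      unfolding J_def by blast
    also have "\<dots> = rect 0 0 m1 n1 \<union> (+) (a, b) ` (\<Union>i\<in>I'. rect (x' i) (y' i) (w' i) (h' i))"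
      unfolding R_ev R_od I(4) by blast
    finally show ?thesis by (simp only: I'(4) tr[symmetric] union)
  qed
  moreover have "interior (R i) \<inter> interior (R j) = {}" if ij: "i \<in> J" "j \<in> J" "i \<noteq> j" for i j
  proof -
    have "interior (R (od i)) \<inter> interior (R (od j)) = {}" if "i \<in> I'" "j \<in> I'" "i \<noteq> j" for i j
    proof -
      have "interior (R (od i)) \<inter> interior (R (od j)) = (+) (a, b) `
          (interior (rect (x' i) (y' i) (w' i) (h' i)) \<inter> interior (rect (x' j) (y' j) (w' j) (h' j)))"
        unfolding R_od interior_translation by (rule image_Int[symmetric]) simp
      then show ?thesis using I'(5)[rule_format, OF that] by simp
    qed
    moreover have "interior (R (ev i)) \<inter> interior (R (ev j)) = {}" if "i \<in> I" "j \<in> I" "i \<noteq> j" for i j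
      using I(5)[rule_format, OF that] by (simp only: R_ev)
    ultimately show ?thesis using ij cross unfolding J_def by blast
  qed
  ultimately show ?thesis
    unfolding rect_partition_def R_def
    by (intro exI[of _ J] exI[of _ W] exI[of _ H] exI[of _ X] exI[of _ Y] conjI) auto
qed

lemma rect_partition_beside:
  assumes "rect_partition m1 n P" "rect_partition m2 n Q"
  shows "rect_partition (m1 + m2) n (P + Q)"
  by (rule rect_partition_join[OF assms, of "real m1" 0])
     (auto simp: rect_def interior_Times)

lemma rect_partition_above:
  assumes "rect_partition m n1 P" "rect_partition m n2 Q"
  shows "rect_partition m (n1 + n2) (P + Q)"
  by (rule rect_partition_join[OF assms, of 0 "real n1"])
     (auto simp: rect_def interior_Times)

text \<open>Size 0 is a separate case: a degenerate rectangle is a nonempty set that no family of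
  proper blocks covers exactly, so \<open>rect_partition\<close> fails there.\<close>

lemma tiling_imp_rect_partition:
  assumes "tiling m n P"
  shows "if m = 0 \<or> n = 0 then P = {#} else rect_partition m n P"
  using assms
proof induction
  case (beside m1 n P m2 Q)
  then show ?case
    by (cases "m1 = 0"; cases "m2 = 0"; cases "n = 0") (auto intro: rect_partition_beside)
next
  case (above m n1 P n2 Q)
  then show ?case
    by (cases "n1 = 0"; cases "n2 = 0"; cases "m = 0") (auto intro: rect_partition_above)
qed (auto intro: rect_partition_single)

text \<open>Each block is read in the orientation in which it is placed, so its horizontal side is
  at most \<open>m\<close>; the areas add up because the blocks form a division of the box.\<close>

lemma rect_partition_weight:
  assumes "rect_partition m n P" "m > 0" "n > 0"
  obtains X where "X \<in> {X. set_mset X \<subseteq> {1..m} \<times> {1..} \<and> (\<Sum>x\<in>#X. case x of (a, b) \<Rightarrow> a * b) = m * n}"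
    "P = image_mset (\<lambda>(a, b). Upair a b) X"
proof -
  obtain I :: "nat set" and w h x y where I: "finite I" "\<forall>i\<in>I. w i > 0 \<and> h i > 0"
    "P = {#Upair (w i) (h i). i \<in># mset_set I#}"
    "(\<Union>i\<in>I. rect (x i) (y i) (w i) (h i)) = rect 0 0 m n"
    "\<forall>i\<in>I. \<forall>j\<in>I. i \<noteq> j \<longrightarrow>
        interior (rect (x i) (y i) (w i) (h i)) \<inter> interior (rect (x j) (y j) (w j) (h j)) = {}"
    using assms(1) unfolding rect_partition_def by (elim exE conjE) (rule that; assumption)
  define R where "R = (\<lambda>i. rect (x i) (y i) (w i) (h i))"
  have R_cbox: "R i = cbox (x i, y i) (x i + real (w i), y i + real (h i))" for i
    by (simp add: R_def rect_def cbox_Pair_eq)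
  have box: "rect 0 0 m n = cbox (0, 0) (real m, real n)"
    by (simp add: rect_def cbox_Pair_eq)
  have ne: "interior (R i) \<noteq> {}" if "i \<in> I" for i
    using I(2)[rule_format, OF that] by (simp add: R_def interior_rect)
  \<comment> \<open>A division is a set of boxes, so its area sum counts every block only if
    distinct indices give distinct rectangles; equal ones would share interior points.\<close>
  have inj: "inj_on R I"
  proof (rule inj_onI, rule ccontr)
    fix i j assume ij: "i \<in> I" "j \<in> I" "R i = R j" "i \<noteq> j"
    then have "interior (R i) \<inter> interior (R j) = {}"
      using I(5)[rule_format, OF ij(1,2,4)] unfolding R_def by simp
    then show False using ne[OF ij(1)] ij(3) by simp
  qed
  have sub: "R i \<subseteq> rect 0 0 m n" if "i \<in> I" for i
    using I(4) that by (auto simp: R_def)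
  have w_le: "w i \<le> m" if "i \<in> I" for i
  proof -
    have "(x i, y i) \<in> R i" "(x i + w i, y i) \<in> R i" by (auto simp: R_def rect_def)
    then have "(x i, y i) \<in> rect 0 0 m n" "(x i + w i, y i) \<in> rect 0 0 m n"
      using sub[OF that] by auto
    then show ?thesis by (auto simp: rect_def)
  qed
  have area_cbox: "measure lborel (cbox (u, v) (u + real a, v + real b)) = real (a * b)" for u v and a b :: nat
    by (simp add: content_Pair)
  have "R ` I division_of cbox (0, 0) (real m, real n)"
    unfolding box[symmetric]
  proof (rule division_ofI)
    fix K assume "K \<in> R ` I"
    then obtain i where i: "i \<in> I" "K = R i" by blast
    show "K \<subseteq> rect 0 0 m n" using sub i by blast
    show "K \<noteq> {}" using ne[OF i(1)] interior_subset[of "R i"] unfolding i(2) by blast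
    show "\<exists>a b. K = cbox a b" unfolding i(2) R_cbox by (intro exI) (rule refl)
    fix K' assume "K' \<in> R ` I" "K \<noteq> K'"
    then obtain j where j: "j \<in> I" "K' = R j" "i \<noteq> j" using i by blast
    then show "interior K \<inter> interior K' = {}"
      using I(5)[rule_format, OF i(1) j(1,3)] unfolding i(2) j(2) R_def by simp
  qed (use I(1,4) in \<open>simp_all add: R_def\<close>)
  then have "(\<Sum>r\<in>R ` I. measure lborel r) = real (m * n)"
    by (subst additive_content_division, assumption) (use area_cbox[of 0 0 m n] in simp)
  moreover have "(\<Sum>r\<in>R ` I. measure lborel r) = (\<Sum>i\<in>I. real (w i * h i))"
    by (subst sum.reindex[OF inj]) (simp add: R_cbox area_cbox)
  ultimately have "real (\<Sum>i\<in>I. w i * h i) = real (m * n)" by simp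
  then have area: "(\<Sum>i\<in>I. w i * h i) = m * n" by (simp only: of_nat_eq_iff)
  define X where "X = image_mset (\<lambda>i. (w i, h i)) (mset_set I)"
  show ?thesis
  proof (rule that[of X])
    show "X \<in> {X. set_mset X \<subseteq> {1..m} \<times> {1..} \<and> (\<Sum>x\<in>#X. case x of (a, b) \<Rightarrow> a * b) = m * n}"
      proof (rule CollectI, rule conjI)
      show "(\<Sum>x\<in>#X. case x of (a, b) \<Rightarrow> a * b) = m * n"
        using area by (simp add: X_def image_mset.compositionality comp_def sum_unfold_sum_mset)
      show "set_mset X \<subseteq> {1..m} \<times> {1..}"
        using I(1,2) w_le by (auto simp: X_def Suc_le_eq)
    qed
    show "P = image_mset (\<lambda>(a, b). Upair a b) X"
      by (simp add: I(3) X_def image_mset.compositionality comp_def)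
  qed
qed

section \<open>Packing strips\<close>

text \<open>The unused part of the rectangle is filled with unit squares.\<close>
definition packs :: "nat \<Rightarrow> nat \<Rightarrow> nat uprod multiset \<Rightarrow> bool" where
  "packs m n P \<longleftrightarrow> (\<exists>f. tiling m n (P + replicate_mset f (Upair 1 1)))"

lemma packs_beside: "packs m1 n P \<Longrightarrow> packs m2 n Q \<Longrightarrow> packs (m1 + m2) n (P + Q)"
  unfolding packs_def
proof (elim exE)
  fix f g assume tilings: "tiling m1 n (P + replicate_mset f (Upair 1 1))" "tiling m2 n (Q + replicate_mset g (Upair 1 1))"
  show "\<exists>f. tiling (m1 + m2) n (P + Q + replicate_mset f (Upair 1 1))"
  proof (intro exI)
    have "P + Q + replicate_mset (f + g) (Upair 1 1)
        = (P + replicate_mset f (Upair 1 1)) + (Q + replicate_mset g (Upair 1 1))"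
      by (rule multiset_eqI) simp
    then show "tiling (m1 + m2) n (P + Q + replicate_mset (f + g) (Upair 1 1))"
      using tiling.beside[OF tilings] by (simp only:)
  qed
qed

lemma packs_above: "packs m n1 P \<Longrightarrow> packs m n2 Q \<Longrightarrow> packs m (n1 + n2) (P + Q)"
  unfolding packs_def
proof (elim exE)
  fix f g assume tilings: "tiling m n1 (P + replicate_mset f (Upair 1 1))" "tiling m n2 (Q + replicate_mset g (Upair 1 1))"
  show "\<exists>f. tiling m (n1 + n2) (P + Q + replicate_mset f (Upair 1 1))"
  proof (intro exI)
    have "P + Q + replicate_mset (f + g) (Upair 1 1)
        = (P + replicate_mset f (Upair 1 1)) + (Q + replicate_mset g (Upair 1 1))"
      by (rule multiset_eqI) simp
    then show "tiling m (n1 + n2) (P + Q + replicate_mset (f + g) (Upair 1 1))"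
      using tiling.above[OF tilings] by (simp only:)
  qed
qed

lemma tiling_imp_packs: "tiling m n P \<Longrightarrow> packs m n P"
  unfolding packs_def by (rule exI[of _ 0]) simp

lemma packs_empty: "packs m n {#}"
proof (induction m)
  case 0
  show ?case by (intro tiling_imp_packs tiling.no_width)
next
  case (Suc m)
  have "packs 1 n {#}"
  proof (induction n)
    case 0
    show ?case by (intro tiling_imp_packs tiling.no_height)
  next
    case (Suc n)
    have "packs 1 1 {#}"
      unfolding packs_def by (rule exI[of _ 1]) (use tiling.block[of 1 1] in simp)
    from packs_above[OF Suc this] show ?case by simp
  qed
  from packs_beside[OF Suc this] show ?case by simp
qed

lemma packs_row:
  assumes "a \<ge> 1" "0 \<notin># B" "sum_mset B \<le> L"
  shows "packs a L (image_mset (Upair a) B)"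
proof -
  have "packs a (sum_mset B) (image_mset (Upair a) B)"
    using assms(2)
  proof (induction B)
    case (add b B)
    then have "packs a b {#Upair a b#}"
      using assms(1) by (intro tiling_imp_packs tiling.block) auto
    from packs_above[OF this add.IH] show ?case using add.prems by simp
  qed (simp add: packs_empty)
  from packs_above[OF this packs_empty, of "L - sum_mset B"] show ?thesis
    using assms(3) by simp
qed

section \<open>Combining rows and distributing parts among them\<close>

lemma packs_sum_beside:
  assumes "finite A" "\<And>a. a \<in> A \<Longrightarrow> packs (h a) n (P a)"
  shows "packs (\<Sum>a\<in>A. h a) n (\<Sum>a\<in>A. P a)"
  using assms by (induction A rule: finite_induct) (auto intro: packs_empty packs_beside)

lemma packs_sum_above:
  assumes "finite A" "\<And>a. a \<in> A \<Longrightarrow> packs m (l a) (P a)"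
  shows "packs m (\<Sum>a\<in>A. l a) (\<Sum>a\<in>A. P a)"
  using assms by (induction A rule: finite_induct) (auto intro: packs_empty packs_above)

text \<open>Elements are added while the sum stays below \<open>l - K\<close>; since each is at most
  \<open>K\<close>, no step overshoots \<open>l\<close>.\<close>

lemma sub_mset_sum_near:
  fixes B :: "nat multiset"
  assumes "set_mset B \<subseteq> {..K}"
  shows "\<exists>C. C \<subseteq># B \<and> sum_mset C \<le> l \<and> (C = B \<or> l \<le> sum_mset C + K)"
  using assms
proof (induction B)
  case (add x B)
  then obtain C where C: "C \<subseteq># B" "sum_mset C \<le> l" "C = B \<or> l \<le> sum_mset C + K" by auto
  show ?case
  proof (cases "l \<le> sum_mset C + K")
    case True
    then show ?thesis using C by (meson subset_mset.order_trans multi_psub_of_add_self subset_mset.less_imp_le)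
  next
    case False
    then show ?thesis using C add.prems by (intro exI[of _ "add_mset x B"]) auto
  qed
qed simp

text \<open>Greedy filling: a row of capacity \<open>l j\<close> either takes all that is left or
  wastes at most \<open>K\<close>, so it can be relied on for \<open>l j - K\<close>.\<close>

lemma split_mset_bounded_sums:
  fixes B :: "nat multiset"
  assumes "finite J" "set_mset B \<subseteq> {1..K}" "sum_mset B \<le> (\<Sum>j\<in>J. l j - K)"
  shows "\<exists>D. (\<Sum>j\<in>J. D j) = B \<and> (\<forall>j\<in>J. sum_mset (D j) \<le> l j)"
  using assms
proof (induction J arbitrary: B rule: finite_induct)
  case empty
  then have "B = {#}" by (cases B) auto
  then show ?case by simp
next
  case (insert j J)
  have "set_mset B \<subseteq> {..K}" using insert.prems(1) by auto
  then obtain C where C: "C \<subseteq># B" "sum_mset C \<le> l j" "C = B \<or> l j \<le> sum_mset C + K"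
    using sub_mset_sum_near[of B K "l j"] by blast
  have B: "B = C + (B - C)" using C(1) by simp
  have "set_mset (B - C) \<subseteq> {1..K}" using insert.prems(1) by (auto dest: in_diffD)
  moreover have "sum_mset (B - C) \<le> (\<Sum>j\<in>J. l j - K)"
  proof -
    have "sum_mset B = sum_mset C + sum_mset (B - C)" using B by (metis sum_mset.union)
    then show ?thesis using C(3) insert.prems(2) insert.hyps by auto
  qed
  ultimately obtain D where D: "(\<Sum>j\<in>J. D j) = B - C" "\<forall>j\<in>J. sum_mset (D j) \<le> l j"
    using insert.IH by blast
  have "(\<Sum>i\<in>J. (D(j := C)) i) = (\<Sum>i\<in>J. D i)"
    using insert.hyps(2) by (intro sum.cong) auto
  then show ?case
    using D C(2) B insert.hyps by (intro exI[of _ "D(j := C)"]) simp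
qed

lemma image_mset_sum: "image_mset f (\<Sum>i\<in>A. g i) = (\<Sum>i\<in>A. image_mset f (g i))"
  by (induction A rule: infinite_finite_induct) auto

lemma packs_section:
  assumes "a \<ge> 1" "set_mset B \<subseteq> {1..K}" "sum_mset B \<le> q * (L - K)"
    and D: "\<And>i. i < r \<Longrightarrow> 0 \<notin># D i \<and> sum_mset (D i) \<le> L"
  shows "packs (q * a + r) L (image_mset (Upair a) B + (\<Sum>i<r. image_mset (Upair 1) (D i)))"
proof (rule packs_beside)
  obtain C where C: "(\<Sum>i<q. C i) = B" "\<forall>i<q. sum_mset (C i) \<le> L"
    using split_mset_bounded_sums[of "{..<q}" B K "\<lambda>_. L"] assms by auto
  have "0 \<notin># C i" if "i < q" for i
  proof -
    have "set_mset (C i) \<subseteq> set_mset B"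
      unfolding C(1)[symmetric] using that by (auto simp: set_mset_sum)
    then show ?thesis using assms(2) by auto
  qed
  then have "packs (\<Sum>i<q. a) L (\<Sum>i<q. image_mset (Upair a) (C i))"
    using C assms(1) by (intro packs_sum_beside packs_row) auto
  moreover have "(\<Sum>i<q. image_mset (Upair a) (C i)) = image_mset (Upair a) B"
    by (simp only: C(1)[symmetric] image_mset_sum)
  ultimately show "packs (q * a) L (image_mset (Upair a) B)" by simp
  have "packs (\<Sum>i<r. 1) L (\<Sum>i<r. image_mset (Upair 1) (D i))"
    using D by (intro packs_sum_beside packs_row) auto
  then show "packs r L (\<Sum>i<r. image_mset (Upair 1) (D i))" by simp
qed

text \<open>The length is cut into sections of length \<open>T a\<close>. Section
  \<open>a > 1\<close> has \<open>m div a\<close> rows of width \<open>a\<close> and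
  \<open>m mod a\<close> unit rows; section 1 has unit rows only and takes the remaining length. The
  parts in \<open>X 1\<close> are spread over the unit rows of all sections, and \<open>area\<close>
  ensures that they fit.\<close>

lemma packs_long_parts:
  assumes m: "m \<ge> 1"
    and X: "\<And>a. a \<in> {1..m} \<Longrightarrow> X a \<in> long_parts m K (N a)"
    and width: "(\<Sum>a=2..m. N a div (m div a)) + m * (K + 1) \<le> n"
    and area: "(\<Sum>a=1..m. a * N a) + m * m * (K + 1) \<le> m * n"
  shows "packs m n (\<Sum>a=1..m. image_mset (Upair a) (X a))"
proof -
  \<comment> \<open>\<open>K\<close> covers the waste in a row, and 1 the rounding in the
    division.\<close>
  define T' where "T' = (\<lambda>a. N a div (m div a) + (K + 1))"
  define T where "T = (\<lambda>a. if a = 1 then n - (\<Sum>a=2..m. T' a) else T' a)"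
  define r where "r = (\<lambda>a. if a = 1 then m else m mod a)"
  define q where "q = (\<lambda>a. if a = 1 then 0 else m div a)"
  have split: "{1..m} = insert 1 {2..m}" using m by auto
  have T_ge: "T a = T' a" if "a \<in> {2..m}" for a using that by (auto simp: T_def)
  have sumT': "(\<Sum>a=2..m. T' a) + K \<le> n"
  proof -
    have "(\<Sum>a=2..m. T' a) = (\<Sum>a=2..m. N a div (m div a)) + (m - 1) * (K + 1)"
      using m unfolding T'_def sum.distrib[of _ "\<lambda>_. K + 1"] sum_constant card_atLeastAtMost by simp
    moreover have "(m - 1) * (K + 1) + K \<le> m * (K + 1)"
      using m by (cases m) auto
    ultimately show ?thesis using width by linarith
  qed
  have sumT: "(\<Sum>a=1..m. T a) = n"
    unfolding split using sumT' T_ge by (simp add: T_def)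
  have T1: "T 1 \<ge> K" using sumT' by (simp add: T_def)
  have TK: "T a \<ge> K" if "a \<in> {1..m}" for a
    using that T1 T_ge by (cases "a = 1") (auto simp: T_def T'_def)
  have qa: "q a * a + r a = m" for a by (simp add: q_def r_def)
  have fits: "N a \<le> q a * (T a - K)" if "a \<in> {2..m}" for a
  proof -
    have "q a > 0" using that by (simp add: q_def div_greater_zero_iff)
    moreover have "T a - K = N a div q a + 1" using that by (simp add: T_def T'_def q_def)
    moreover have "N a \<le> q a * (N a div q a) + q a"
      using mult_div_mod_eq[of "q a" "N a"] mod_less_divisor[OF \<open>q a > 0\<close>, of "N a"] by linarith
    ultimately show ?thesis by (simp add: algebra_simps)
  qed
  \<comment> \<open>Of the area \<open>m * n\<close>, \<open>m * m * K\<close> is set aside as waste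
    and rounding costs at most \<open>m\<close> per section; what the wide blocks leave belongs to
    the unit rows.\<close>
  have ones: "N 1 \<le> (\<Sum>a=1..m. r a * (T a - K))"
  proof -
    have "(\<Sum>a=1..m. q a * a * (T a - K)) = (\<Sum>a=2..m. q a * a * (T a - K))"
      unfolding split by (simp add: q_def)
    also have "\<dots> \<le> (\<Sum>a=2..m. a * N a + m)"
    proof (intro sum_mono)
      fix a assume a: "a \<in> {2..m}"
      have "q a * a * (T a - K) = a * (N a div q a * q a) + q a * a"
        using a by (simp add: T_def T'_def q_def algebra_simps)
      also have "\<dots> \<le> a * N a + m"
        using qa[of a] by (intro add_mono mult_le_mono2) auto
      finally show "q a * a * (T a - K) \<le> a * N a + m" .
    qed
    also have "\<dots> \<le> (\<Sum>a=2..m. a * N a) + m * m"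
      by (simp add: sum.distrib)
    finally have 1: "(\<Sum>a=1..m. q a * a * (T a - K)) \<le> (\<Sum>a=2..m. a * N a) + m * m" .
    have "(\<Sum>a=1..m. q a * a * (T a - K)) + (\<Sum>a=1..m. r a * (T a - K)) + m * m * K
        = (\<Sum>a=1..m. m * (T a - K) + m * K)"
      by (simp add: sum.distrib[symmetric] add_mult_distrib[symmetric] qa)
         (simp add: sum.distrib)
    also have "\<dots> = (\<Sum>a=1..m. m * T a)"
      using TK by (intro sum.cong refl) (simp add: add_mult_distrib2[symmetric])
    also have "\<dots> = m * n" by (simp only: sum_distrib_left[symmetric] sumT)
    finally have 2: "(\<Sum>a=1..m. q a * a * (T a - K)) + (\<Sum>a=1..m. r a * (T a - K)) + m * m * K = m * n" .
    have "(\<Sum>a=1..m. a * N a) = N 1 + (\<Sum>a=2..m. a * N a)"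
      unfolding split by simp
    moreover have "m * m * (K + 1) = m * m * K + m * m" by simp
    ultimately show ?thesis using 1 2 area by linarith
  qed
  let ?J = "SIGMA a:{1..m}. {..<r a}"
  have X_sub: "set_mset (X a) \<subseteq> {1..K}" "sum_mset (X a) \<le> N a" if "a \<in> {1..m}" for a
    using X[OF that] by (auto simp: long_parts_def)
  have "\<exists>D. (\<Sum>j\<in>?J. D j) = X 1 \<and> (\<forall>j\<in>?J. sum_mset (D j) \<le> T (fst j))"
  proof (rule split_mset_bounded_sums)
    have "(\<Sum>j\<in>?J. T (fst j) - K) = (\<Sum>a=1..m. r a * (T a - K))"
    proof -
      have "(\<Sum>a=1..m. \<Sum>i<r a. T a - K) = (\<Sum>(a, i)\<in>?J. T a - K)"
        by (rule sum.Sigma) auto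
      then show ?thesis by (simp add: case_prod_unfold)
    qed
    then show "sum_mset (X 1) \<le> (\<Sum>j\<in>?J. T (fst j) - K)"
      using ones X_sub(2)[of 1] m by simp
    show "set_mset (X 1) \<subseteq> {1..K}" using X_sub(1)[of 1] m by simp
  qed simp
  then obtain D where D: "(\<Sum>j\<in>?J. D j) = X 1" "\<And>j. j \<in> ?J \<Longrightarrow> sum_mset (D j) \<le> T (fst j)"
    by blast
  have D0: "0 \<notin># D j" if "j \<in> ?J" for j
  proof -
    have "set_mset (D j) \<subseteq> set_mset (X 1)"
      unfolding D(1)[symmetric] using that by (subst set_mset_sum) auto
    then show ?thesis using X_sub(1)[of 1] m by auto
  qed
  let ?B = "\<lambda>a. if a = 1 then {#} else X a"
  have "packs m (\<Sum>a=1..m. T a) (\<Sum>a=1..m. image_mset (Upair a) (?B a) + (\<Sum>i<r a. image_mset (Upair 1) (D (a, i))))"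
  proof (rule packs_sum_above)
    fix a assume a: "a \<in> {1..m}"
    have "packs (q a * a + r a) (T a) (image_mset (Upair a) (?B a) + (\<Sum>i<r a. image_mset (Upair 1) (D (a, i))))"
    proof (rule packs_section)
      show "a \<ge> 1" using a by simp
      show "set_mset (?B a) \<subseteq> {1..K}" using X_sub(1)[OF a] by simp
      show "sum_mset (?B a) \<le> q a * (T a - K)"
        using X_sub(2)[OF a] fits[of a] a by (cases "a = 1") auto
      show "0 \<notin># D (a, i) \<and> sum_mset (D (a, i)) \<le> T a" if "i < r a" for i
        using D0[of "(a, i)"] D(2)[of "(a, i)"] a that by auto
    qed
    then show "packs m (T a) (image_mset (Upair a) (?B a) + (\<Sum>i<r a. image_mset (Upair 1) (D (a, i))))"
      by (simp only: qa)
  qed simp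
  moreover have "(\<Sum>a=1..m. image_mset (Upair a) (?B a) + (\<Sum>i<r a. image_mset (Upair 1) (D (a, i))))
      = (\<Sum>a=1..m. image_mset (Upair a) (X a))"
  proof -
    have "(\<Sum>a=1..m. \<Sum>i<r a. image_mset (Upair 1) (D (a, i))) = (\<Sum>j\<in>?J. image_mset (Upair 1) (D j))"
      by (subst sum.Sigma) (auto simp: case_prod_unfold)
    also have "\<dots> = image_mset (Upair 1) (X 1)" by (simp only: image_mset_sum[symmetric] D(1))
    finally have "(\<Sum>a=1..m. image_mset (Upair a) (?B a) + (\<Sum>i<r a. image_mset (Upair 1) (D (a, i))))
      = (\<Sum>a=1..m. image_mset (Upair a) (?B a)) + image_mset (Upair 1) (X 1)"
      by (simp add: sum.distrib)
    also have "(\<Sum>a=1..m. image_mset (Upair a) (?B a)) = (\<Sum>a=2..m. image_mset (Upair a) (X a))"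
      unfolding split by simp
    finally show ?thesis unfolding split by (simp add: add.commute)
  qed
  ultimately show ?thesis by (simp only: sumT)
qed

section \<open>Comparing partitions of the rectangle with multisets\<close>

lemma finite_rect_partitions:
  assumes "m \<ge> 1" "n \<ge> 1"
  shows "finite {P. rect_partition m n P}"
    and "num_rect_partitions m n \<le> num_weighted (\<lambda>(a, b). a * b) ({1..m} \<times> {1..}) (m * n)"
proof -
  interpret weights "\<lambda>(a, b). a * b" "{1..m} \<times> {1..}" by (rule weights_blocks)
  let ?W = "weighted_msets (\<lambda>(a, b). a * b) ({1..m} \<times> {1..}) (m * n)"
  \<comment> \<open>A block with distinct sides at most \<open>m\<close> corresponds to two ordered
    pairs; the map only has to reach every partition.\<close>
  have sub: "{P. rect_partition m n P} \<subseteq> image_mset (\<lambda>(a, b). Upair a b) ` ?W"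
  proof
    fix P assume "P \<in> {P. rect_partition m n P}"
    then obtain X where X: "X \<in> ?W" "P = image_mset (\<lambda>(a, b). Upair a b) X"
      unfolding weighted_msets_def using rect_partition_weight[of m n P] assms by auto
    then show "P \<in> image_mset (\<lambda>(a, b). Upair a b) ` ?W" by (intro image_eqI)
  qed
  have fin: "finite (image_mset (\<lambda>(a, b). Upair a b) ` ?W)"
    by (intro finite_imageI finite_weighted_msets)
  show "finite {P. rect_partition m n P}" by (rule finite_subset[OF sub fin])
  have "num_rect_partitions m n \<le> card (image_mset (\<lambda>(a, b). Upair a b) ` ?W)"
    unfolding num_rect_partitions_def by (rule card_mono[OF fin sub])
  also have "\<dots> \<le> num_weighted (\<lambda>(a, b). a * b) ({1..m} \<times> {1..}) (m * n)"
    unfolding num_weighted_def by (rule card_image_le[OF finite_weighted_msets])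
  finally show "num_rect_partitions m n \<le> num_weighted (\<lambda>(a, b). a * b) ({1..m} \<times> {1..}) (m * n)" .
qed

text \<open>As \<open>a \<le> m < b\<close>, the unordered pair determines its width, so every
  \<open>X a\<close> can be read off from the blocks; neither other widths nor the unit squares
  interfere.\<close>

lemma count_Upair_sum:
  fixes X :: "nat \<Rightarrow> nat multiset" and a b m f :: nat
  assumes "\<And>a. a \<in> {1..m} \<Longrightarrow> set_mset (X a) \<subseteq> {m<..}" "a \<in> {1..m}" "b > m"
  shows "count ((\<Sum>a=1..m. image_mset (Upair a) (X a)) + replicate_mset f (Upair 1 1)) (Upair a b) = count (X a) b"
proof -
  have "count (replicate_mset f (Upair 1 1)) (Upair a b) = 0" using assms(2,3) by auto
  then have "count ((\<Sum>a=1..m. image_mset (Upair a) (X a)) + replicate_mset f (Upair 1 1)) (Upair a b)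
      = (\<Sum>a'=1..m. count (image_mset (Upair a') (X a')) (Upair a b))"
    by (simp only: count_union count_sum add_0_right)
  also have "\<dots> = (\<Sum>a'=1..m. if a' = a then count (X a) b else 0)"
  proof (intro sum.cong refl)
    fix a' assume a': "a' \<in> {1..m}"
    show "count (image_mset (Upair a') (X a')) (Upair a b) = (if a' = a then count (X a) b else 0)"
    proof (cases "a' = a")
      case True
      have "count (image_mset (Upair a) M) (Upair a b) = count M b" for M
        by (induction M) auto
      then show ?thesis using True by simp
    next
      case False
      have "Upair a b \<notin># image_mset (Upair a') (X a')"
        using False a' assms(3) by auto
      then show ?thesis using False by (simp only: not_in_iff if_False)
    qed
  qed
  also have "\<dots> = count (X a) b" using assms(2) by simp
  finally show ?thesis .
qed

lemma prod_card_long_parts_le: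
  assumes m: "m \<ge> 1"
    and width: "(\<Sum>a=2..m. N a div (m div a)) + m * (K + 1) \<le> n"
    and area: "(\<Sum>a=1..m. a * N a) + m * m * (K + 1) \<le> m * n"
  shows "(\<Prod>a=1..m. card (long_parts m K (N a))) \<le> num_rect_partitions m n"
proof -
  have "m * 1 \<le> m * (K + 1)" by (intro mult_le_mono2) simp
  then have n: "n \<ge> 1" using width m by linarith
  let ?S = "\<lambda>X. \<Sum>a=1..m. image_mset (Upair a) (X a)"
  let ?L = "\<Pi>\<^sub>E a\<in>{1..m}. long_parts m K (N a)"
  have "\<exists>f. rect_partition m n (?S X + replicate_mset f (Upair 1 1))" if "X \<in> ?L" for X
  proof -
    have "packs m n (?S X)"
      by (rule packs_long_parts[OF m _ width area]) (use that in auto)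
    then obtain f where "tiling m n (?S X + replicate_mset f (Upair 1 1))"
      unfolding packs_def by blast
    from tiling_imp_rect_partition[OF this] show ?thesis using m n by auto
  qed
  then obtain f where f: "\<And>X. X \<in> ?L \<Longrightarrow> rect_partition m n (?S X + replicate_mset (f X) (Upair 1 1))"
    by metis
  have "card ?L \<le> num_rect_partitions m n"
    unfolding num_rect_partitions_def
  proof (rule card_inj_on_le)
    show "inj_on (\<lambda>X. ?S X + replicate_mset (f X) (Upair 1 1)) ?L"
    proof (rule inj_onI)
      fix X Y assume XY: "X \<in> ?L" "Y \<in> ?L"
        "?S X + replicate_mset (f X) (Upair 1 1) = ?S Y + replicate_mset (f Y) (Upair 1 1)"
      have sub: "set_mset (X a) \<subseteq> {m<..}" "set_mset (Y a) \<subseteq> {m<..}" if "a \<in> {1..m}" for a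
        using XY(1,2) that by (auto simp: long_parts_def dest!: PiE_mem)
      show "X = Y"
      proof (rule PiE_ext[OF XY(1,2)])
        fix a assume a: "a \<in> {1..m}"
        show "X a = Y a"
        proof (rule multiset_eqI)
          fix b
          show "count (X a) b = count (Y a) b"
          proof (cases "b > m")
            case True
            have "count (X a) b = count (?S X + replicate_mset (f X) (Upair 1 1)) (Upair a b)"
              by (rule count_Upair_sum[symmetric]) (use sub a True in auto)
            also have "\<dots> = count (Y a) b"
              unfolding XY(3) by (rule count_Upair_sum) (use sub a True in auto)
            finally show ?thesis .
          next
            case False
            then have "b \<notin># X a" "b \<notin># Y a" using sub[OF a] by auto
            then show ?thesis by (simp add: not_in_iff)
          qed
        qed
      qed
    qed
  qed (use f finite_rect_partitions(1)[OF m n] in auto)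
  then show ?thesis by (simp add: card_PiE)
qed

section \<open>The asymptotic formula\<close>

lemma sum_reflected_harm:
  assumes "1 \<le> h" "h \<le> m"
  shows "(\<Sum>a=2..h. 1 / (real m - real a + 1)) = harm (m - 1) - harm (m - h)"
  using assms
proof (induction h rule: dec_induct)
  case (step h)
  have "m - h = Suc (m - Suc h)" using step.prems by simp
  then have "harm (m - h) = harm (m - Suc h) + 1 / (real m - real h)"
    by (simp add: harm_Suc inverse_eq_divide of_nat_diff)
  then show ?case using step by simp
qed simp

text \<open>For \<open>c = m\<close> the summand is \<open>(m - a) / (a * (a - 1))\<close> in
  partial fractions, which bounds the excess of the terms with \<open>m div a = 1\<close>.\<close>

lemma sum_telescope_harm:
  fixes c :: real
  assumes "1 \<le> h" "h \<le> k"
  shows "(\<Sum>a=h+1..k. c / (real a - 1) - c / real a - 1 / (real a - 1))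
    = c / real h - c / real k - (harm (k - 1) - harm (h - 1))"
  using assms(2)
proof (induction k rule: dec_induct)
  case (step k)
  have "harm k = harm (k - 1) + 1 / real k"
    using step assms(1) by (cases k) (simp_all add: harm_Suc inverse_eq_divide)
  then show ?case using step assms(1) by simp
qed simp

text \<open>
  With \<open>m = q a + r\<close>, the summand on the left is \<open>1/a + r/(a\<^sup>2 q)\<close>, so the claim is that the sum
  of the excesses \<open>r/(a\<^sup>2 q)\<close> is at most 1.  For \<open>a \<le> m/2\<close> they are bounded using \<open>r < a\<close>
  and for \<open>a > m/2\<close> using \<open>q = 1\<close>.
\<close>
lemma sum_floor_le_harm:
  assumes "m \<ge> 1"
  shows "(\<Sum>a=2..m. real m / (real a ^ 2 * real (m div a))) \<le> harm m"
proof (cases "m = 1")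
  case False
  define h where "h = m div 2"
  have m: "m \<ge> 2" using False assms by simp
  then have h: "1 \<le> h" "h \<le> m" by (auto simp: h_def)
  let ?e = "\<lambda>a. real (m mod a) / (real a ^ 2 * real (m div a))"
  have split: "{2..m} = {2..h} \<union> {h+1..m}" "{2..h} \<inter> {h+1..m} = {}" using h by auto
  have "(\<Sum>a=2..h. ?e a) \<le> (\<Sum>a=2..h. 1 / (real m - real a + 1))"
  proof (intro sum_mono)
    fix a assume a: "a \<in> {2..h}"
    then have a': "a \<ge> 2" "2 * a \<le> m" by (auto simp: h_def)
    have r: "m mod a < a" using a' by simp
    have qr: "real (m div a) * real a = real m - real (m mod a)"
      by (metis add_diff_cancel_right' div_mult_mod_eq of_nat_add of_nat_mult)
    have "?e a = real (m mod a) / real a / (real m - real (m mod a))"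
      unfolding qr[symmetric] by (simp add: power2_eq_square mult_ac)
    also have "\<dots> \<le> 1 / (real m - real a + 1)"
    proof (rule frac_le)
      show "real m - real a + 1 \<le> real m - real (m mod a)" using r by linarith
    qed (use r a' in auto)
    finally show "?e a \<le> 1 / (real m - real a + 1)" .
  qed
  also have "\<dots> = harm (m - 1) - harm (m - h)" by (rule sum_reflected_harm[OF h])
  finally have 1: "(\<Sum>a=2..h. ?e a) \<le> harm (m - 1) - harm (m - h)" .
  have "(\<Sum>a=h+1..m. ?e a) \<le> (\<Sum>a=h+1..m. real m / (real a - 1) - real m / real a - 1 / (real a - 1))"
  proof (intro sum_mono)
    fix a assume a: "a \<in> {h+1..m}"
    then have a': "a \<ge> 2" "a \<le> m" "m < 2 * a" using h by (auto simp: h_def)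
    then have q: "m div a = 1" by (intro div_nat_eqI) auto
    then have r: "m mod a = m - a" by (simp add: modulo_nat_def)
    have "?e a = (real m - real a) / (real a * real a)"
      using a' by (simp add: q r of_nat_diff power2_eq_square)
    also have "\<dots> \<le> (real m - real a) / (real a * (real a - 1))"
      using a' by (intro divide_left_mono mult_left_mono) auto
    also have "\<dots> = real m / (real a - 1) - real m / real a - 1 / (real a - 1)"
    proof -
      have "real a \<noteq> 0" "real a - 1 \<noteq> 0" using a'(1) by auto
      then show ?thesis by (simp add: divide_simps) (simp add: algebra_simps)
    qed
    finally show "?e a \<le> real m / (real a - 1) - real m / real a - 1 / (real a - 1)" .
  qed
  also have "\<dots> = real m / real h - 1 - (harm (m - 1) - harm (h - 1))"
    using sum_telescope_harm[OF h, of "real m"] m by simp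
  finally have 2: "(\<Sum>a=h+1..m. ?e a) \<le> real m / real h - 1 - (harm (m - 1) - harm (h - 1))" .
  \<comment> \<open>In the sum of the two bounds \<open>harm (m - 1)\<close> cancels. For
    \<open>m = 2 * h\<close> and \<open>m = 2 * h + 1\<close> the remainder is
    \<open>1 - 1/h\<close> and \<open>1 - 1/(h + 1)\<close>.\<close>
  have 3: "real m / real h - 1 - harm (m - h) + harm (h - 1) \<le> 1"
  proof -
    have hh: "harm h = (harm (h - 1) :: real) + 1 / real h"
      using h(1) by (cases h) (simp_all add: harm_Suc inverse_eq_divide)
    show ?thesis
    proof (cases "even m")
      case True
      then have "m = h + h" by (auto simp: h_def)
      then show ?thesis using hh h(1) by (simp add: add_divide_distrib)
    next
      case False
      then have "m = Suc (h + h)" by (auto simp: h_def elim!: oddE)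
      moreover from this have "m - h = Suc h" by simp
      ultimately show ?thesis using hh h(1)
        by (simp add: harm_Suc add_divide_distrib inverse_eq_divide)
    qed
  qed
  have "(\<Sum>a=2..m. real m / (real a ^ 2 * real (m div a))) = (\<Sum>a=2..m. 1 / real a + ?e a)"
  proof (intro sum.cong refl)
    fix a assume "a \<in> {2..m}"
    then have pos: "real a > 0" "real (m div a) > 0" by (auto simp: div_greater_zero_iff)
    have "real m = real (m div a) * real a + real (m mod a)"
      by (metis div_mult_mod_eq of_nat_add of_nat_mult)
    then show "real m / (real a ^ 2 * real (m div a)) = 1 / real a + ?e a"
      using pos by (simp add: field_simps power2_eq_square)
  qed
  also have "\<dots> = (\<Sum>a=2..m. 1 / real a) + ((\<Sum>a=2..h. ?e a) + (\<Sum>a=h+1..m. ?e a))"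
    unfolding sum.distrib by (subst (2) split(1), subst sum.union_disjoint) (use split(2) in auto)
  also have "\<dots> \<le> (\<Sum>a=2..m. 1 / real a) + 1" using 1 2 3 by linarith
  also have "\<dots> = harm m"
  proof -
    have "{1..m} = insert 1 {2..m}" using m by auto
    then show ?thesis by (simp add: harm_def inverse_eq_divide)
  qed
  finally show ?thesis .
qed (simp add: harm_nonneg)

section \<open>The two bounds for the number of partitions\<close>

lemma num_rect_partitions_le:
  assumes "m \<ge> 1" "n \<ge> 1"
  shows "real (num_rect_partitions m n) \<le> exp (pi * sqrt (2 * real m * harm m / 3) * sqrt (real n))"
proof -
  have "real (num_rect_partitions m n) \<le> exp (pi * sqrt (2 * harm m / 3) * sqrt (real (m * n)))"
    using finite_rect_partitions(2)[OF assms] num_weighted_blocks_le[OF assms(1), of "m * n"]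
    by (simp only: of_nat_le_iff[symmetric, where ?'a = real])
  also have "pi * sqrt (2 * harm m / 3) * sqrt (real (m * n)) = pi * sqrt (2 * real m * harm m / 3) * sqrt (real n)"
    by (simp add: real_sqrt_mult[symmetric] mult_ac)
  finally show ?thesis .
qed

lemma eventually_sqrt_ln_le:
  fixes a b :: real
  shows "eventually (\<lambda>n::nat. a * (sqrt (real n) * ln (real n)) + b \<le> real n) sequentially"
proof -
  have "(\<lambda>n::nat. sqrt (real n) * ln (real n) / real n) \<longlonglongrightarrow> 0" by real_asymp
  moreover have "(\<lambda>n::nat. 1 / real n) \<longlonglongrightarrow> 0" by real_asymp
  ultimately have "(\<lambda>n::nat. a * (sqrt (real n) * ln (real n) / real n) + b * (1 / real n)) \<longlonglongrightarrow> a * 0 + b * 0"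
    by (intro tendsto_intros)
  then have "eventually (\<lambda>n::nat. a * (sqrt (real n) * ln (real n) / real n) + b * (1 / real n) < 1) sequentially"
    by (rule order_tendstoD) simp
  then show ?thesis
    using eventually_gt_at_top[of 0]
    by eventually_elim (simp add: field_simps)
qed

lemma ln_num_rect_partitions_ge:
  fixes m :: nat
  assumes m: "m \<ge> 1"
  obtains A where "eventually (\<lambda>n. num_rect_partitions m n > 0 \<and>
     ln (real (num_rect_partitions m n)) \<ge> pi * sqrt (2 * real m * harm m / 3) * sqrt (real n) - A * ln (real n)) sequentially"
proof -
  define c where "c = pi * sqrt (2 / 3)"
  have c: "c > 0" by (simp add: c_def)
  define H where "H = (harm m :: real)"
  have H: "H \<ge> 1"
  proof -
    have "(\<Sum>k\<in>{1}. inverse (real k)) \<le> (\<Sum>k=1..m. inverse (real k))"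
      using m by (intro sum_mono2) auto
    then show ?thesis by (simp add: H_def harm_def)
  qed
  have C: "pi * sqrt (2 * real m * harm m / 3) = c * sqrt (real m * H)"
    unfolding c_def H_def by (simp add: real_sqrt_mult[symmetric] mult_ac)
  obtain \<delta> B \<kappa> :: real where const: "\<delta> > 0" "B \<ge> 0" "\<kappa> \<ge> 0" and long:
    "\<And>M N K :: nat. M \<ge> 2 \<Longrightarrow> 1 \<le> N \<Longrightarrow> N \<le> M \<Longrightarrow> real K \<ge> \<kappa> * sqrt (real M) * ln (real M) \<Longrightarrow>
       real (card (long_parts m K N)) \<ge> \<delta> * real M powr (-B) * exp (c * sqrt (real N))"
    using long_parts_lower_bound[of m] unfolding c_def by metis
  \<comment> \<open>The terms come from \<delta>, from the power of \<open>m * n \<le> n^2\<close>,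
    from the length set aside for waste, and from rounding \<open>N a\<close>.\<close>
  define A where "A = real m * \<bar>ln \<delta>\<bar> + 2 * real m * B + c * sqrt (real m * H) * (real m * (2 * \<kappa> * sqrt (real m) + 2)) + c * real m"
  \<comment> \<open>This threshold gives \<open>Y \<ge> H * m\<close>, hence
    \<open>z a \<ge> 1\<close> for all \<open>a \<le> m\<close>.\<close>
  have "eventually (\<lambda>n. real m * (2 * \<kappa> * sqrt (real m)) * (sqrt (real n) * ln (real n)) + (2 * real m + H * real m) \<le> real n) sequentially"
    by (rule eventually_sqrt_ln_le)
  then have "eventually (\<lambda>n. num_rect_partitions m n > 0 \<and>
     ln (real (num_rect_partitions m n)) \<ge> pi * sqrt (2 * real m * harm m / 3) * sqrt (real n) - A * ln (real n)) sequentially"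
    using eventually_ge_at_top[of "max 3 m"]
  proof eventually_elim
    case (elim n)
    then have n: "n \<ge> 3" "n \<ge> m" by auto
    have ln1: "1 \<le> ln (real n)"
    proof -
      have "exp 1 \<le> real n" using e_less_272 n(1) by simp
      then show ?thesis using n(1) by (subst ln_ge_iff) auto
    qed
    have mn: "ln (real (m * n)) \<le> 2 * ln (real n)"
      using n m by (simp add: ln_mult)
    have M: "m * n \<ge> 2" using n m mult_le_mono[of 1 m 2 n] by simp
    define K where "K = nat \<lceil>\<kappa> * sqrt (real (m * n)) * ln (real (m * n))\<rceil>"
    have lnM: "ln (real (m * n)) \<ge> 0" using M by (intro ln_ge_zero) linarith
    have K: "real K \<ge> \<kappa> * sqrt (real (m * n)) * ln (real (m * n))"
      unfolding K_def by linarith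
    have "0 \<le> \<kappa> * sqrt (real (m * n)) * ln (real (m * n))"
      using const(3) lnM by (intro mult_nonneg_nonneg) auto
    then have "real K \<le> \<kappa> * sqrt (real (m * n)) * ln (real (m * n)) + 1"
      unfolding K_def by linarith
    also have "\<kappa> * sqrt (real (m * n)) * ln (real (m * n)) \<le> \<kappa> * sqrt (real (m * n)) * (2 * ln (real n))"
      using const mn by (intro mult_left_mono) auto
    finally have K_le: "real K + 1 \<le> 2 * \<kappa> * sqrt (real m) * (sqrt (real n) * ln (real n)) + 2"
      by (simp add: real_sqrt_mult mult_ac)
    \<comment> \<open>The length that remains after the allowance \<open>m * (K + 1)\<close> for
      waste and rounding.\<close>
    define Y where "Y = real n - real m * (real K + 1)"
    have mK: "real m * (real K + 1) \<le> real m * (2 * \<kappa> * sqrt (real m)) * (sqrt (real n) * ln (real n)) + 2 * real m"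
      using mult_left_mono[OF K_le, of "real m"] by (simp add: algebra_simps)
    have Y_ge: "Y \<ge> H * real m" using mK elim(1) by (simp add: Y_def)
    have "H * real m > 0" using H m by (intro mult_pos_pos) auto
    then have Y: "Y > 0" using Y_ge by linarith
    have Yn: "Y \<le> real n" by (simp add: Y_def)
    \<comment> \<open>Proportionality to \<open>1/a^2\<close> maximizes the sum of
      \<open>sqrt (z a)\<close> for a given total area; the constant makes that area
      \<open>Y * m\<close>.\<close>
    define z where "z = (\<lambda>a. Y * real m / (H * real a ^ 2))"
    define N where "N = (\<lambda>a. nat \<lfloor>z a\<rfloor>)"
    have z: "z a \<ge> 1" "z a \<le> real m * real n" if "a \<in> {1..m}" for a
    proof -
      have a: "real a \<ge> 1" "real a \<le> real m" using that by auto
      have "H * real a ^ 2 \<le> H * real m ^ 2" using a H by (intro mult_left_mono power_mono) auto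
      also have "\<dots> \<le> Y * real m"
        using mult_right_mono[OF Y_ge, of "real m"] by (simp add: power2_eq_square mult_ac)
      finally have le: "H * real a ^ 2 \<le> Y * real m" .
      have pos: "H * real a ^ 2 > 0" using a H by (intro mult_pos_pos zero_less_power) linarith+
      show "z a \<ge> 1" unfolding z_def using le pos by (subst le_divide_eq_1_pos)
      have "1 * 1 \<le> H * real a ^ 2" using a H by (intro mult_mono one_le_power) auto
      then have "z a \<le> Y * real m / 1" unfolding z_def using Y pos by (intro divide_left_mono) simp_all
      also have "\<dots> \<le> real n * real m / 1" using Yn by (intro divide_right_mono mult_right_mono) auto
      finally show "z a \<le> real m * real n" by (simp add: mult.commute)
    qed
    have N: "real (N a) \<le> z a" "real (N a) \<ge> z a - 1" "N a \<ge> 1" "N a \<le> m * n" if "a \<in> {1..m}" for a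
    proof -
      have "\<lfloor>z a\<rfloor> \<ge> 1" using z(1)[OF that] by linarith
      then show 1: "real (N a) \<le> z a" "real (N a) \<ge> z a - 1" "N a \<ge> 1" unfolding N_def by linarith+
      have "real (N a) \<le> real (m * n)" using 1(1) z(2)[OF that] by simp
      then show "N a \<le> m * n" by (simp only: of_nat_le_iff)
    qed
    \<comment> \<open>The choice that is optimal for the area also fits lengthwise, by
      \<open>sum_floor_le_harm\<close>.\<close>
    have width: "(\<Sum>a=2..m. N a div (m div a)) + m * (K + 1) \<le> n"
    proof -
      have "real (\<Sum>a=2..m. N a div (m div a)) \<le> (\<Sum>a=2..m. Y / H * (real m / (real a ^ 2 * real (m div a))))"
        unfolding of_nat_sum
      proof (intro sum_mono)
        fix a assume a: "a \<in> {2..m}"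
        have "real (N a div (m div a)) \<le> real (N a) / real (m div a)" by (rule of_nat_div_le_of_nat)
        also have "\<dots> \<le> z a / real (m div a)" using N(1)[of a] a by (intro divide_right_mono) auto
        also have "\<dots> = Y / H * (real m / (real a ^ 2 * real (m div a)))" by (simp add: z_def)
        finally show "real (N a div (m div a)) \<le> Y / H * (real m / (real a ^ 2 * real (m div a)))" .
      qed
      also have "\<dots> \<le> Y / H * H"
        unfolding sum_distrib_left[symmetric] H_def
        using sum_floor_le_harm[OF m] Y H by (intro mult_left_mono) (auto simp: H_def)
      also have "\<dots> = Y" using H by simp
      finally have "real ((\<Sum>a=2..m. N a div (m div a)) + m * (K + 1)) \<le> real n"
        by (simp add: Y_def algebra_simps)
      then show ?thesis by (simp only: of_nat_le_iff)
    qed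
    have area: "(\<Sum>a=1..m. a * N a) + m * m * (K + 1) \<le> m * n"
    proof -
      have "real (\<Sum>a=1..m. a * N a) \<le> (\<Sum>a=1..m. Y * real m / H * inverse (real a))"
        unfolding of_nat_sum
      proof (intro sum_mono)
        fix a assume a: "a \<in> {1..m}"
        have "real (a * N a) \<le> real a * z a" using N(1)[OF a] by (simp add: mult_left_mono)
        also have "\<dots> = Y * real m / H * inverse (real a)"
          using a H by (simp add: z_def power2_eq_square field_simps)
        finally show "real (a * N a) \<le> Y * real m / H * inverse (real a)" .
      qed
      also have "\<dots> = Y * real m / H * H"
        unfolding sum_distrib_left[symmetric] H_def by (simp add: harm_def)
      also have "\<dots> = Y * real m" using H by simp
      finally have "real ((\<Sum>a=1..m. a * N a) + m * m * (K + 1)) \<le> real (m * n)"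
        by (simp add: Y_def algebra_simps)
      then show ?thesis by (simp only: of_nat_le_iff)
    qed
    define lo where "lo = (\<lambda>a. \<delta> * real (m * n) powr (-B) * exp (c * sqrt (real (N a))))"
    have M0: "real (m * n) > 0" using M by linarith
    have lo_pos: "lo a > 0" for a
      unfolding lo_def using const(1) M0 by (simp del: of_nat_mult)
    have "(\<Prod>a=1..m. lo a) \<le> (\<Prod>a=1..m. real (card (long_parts m K (N a))))"
      unfolding lo_def using const N K M
      by (intro prod_mono conjI long mult_nonneg_nonneg) auto
    also have "\<dots> \<le> real (num_rect_partitions m n)"
      using prod_card_long_parts_le[OF m width area] by (simp only: of_nat_prod[symmetric] of_nat_le_iff)
    finally have prod_le: "(\<Prod>a=1..m. lo a) \<le> real (num_rect_partitions m n)" .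
    have prod_pos: "(\<Prod>a=1..m. lo a) > 0" by (intro prod_pos) (auto simp: lo_pos)
    have p_pos: "num_rect_partitions m n > 0" using prod_le prod_pos by simp
    have "ln (\<Prod>a=1..m. lo a) \<le> ln (real (num_rect_partitions m n))"
      using prod_le prod_pos by (intro ln_mono) auto
    moreover have "ln (\<Prod>a=1..m. lo a) = (\<Sum>a=1..m. ln (lo a))"
      using lo_pos by (intro ln_prod) (auto simp: less_imp_neq[symmetric])
    moreover have "(\<Sum>a=1..m. ln (lo a)) \<ge> (\<Sum>a=1..m. (ln \<delta> - B * ln (real (m * n)) - c) + c * sqrt (Y * real m / H) * inverse (real a))"
    proof (intro sum_mono)
      fix a assume a: "a \<in> {1..m}"
      \<comment> \<open>Since \<open>z a \<ge> 1\<close>, rounding down costs at most 1 in the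
        square root.\<close>
      have "sqrt (z a) - 1 \<le> sqrt (real (N a))"
      proof -
        have "sqrt (z a) \<ge> 1" using z(1)[OF a] by simp
        then have "(sqrt (z a) - 1)\<^sup>2 \<le> z a - 1"
          using z(1)[OF a] by (simp add: power2_diff)
        also have "\<dots> \<le> real (N a)" by (rule N(2)[OF a])
        finally show ?thesis by (rule real_le_rsqrt)
      qed
      then have "c * (sqrt (z a) - 1) \<le> c * sqrt (real (N a))" using c by (intro mult_left_mono) auto
      moreover have "sqrt (z a) = sqrt (Y * real m / H) * inverse (real a)"
        by (simp add: z_def real_sqrt_divide real_sqrt_mult field_simps)
      moreover have "ln (lo a) = ln \<delta> - B * ln (real (m * n)) + c * sqrt (real (N a))"
        using const(1) M0 by (simp add: lo_def ln_mult_pos ln_powr del: of_nat_mult)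
      ultimately show "(ln \<delta> - B * ln (real (m * n)) - c) + c * sqrt (Y * real m / H) * inverse (real a) \<le> ln (lo a)"
        by (simp add: algebra_simps)
    qed
    moreover have "(\<Sum>a=1..m. (ln \<delta> - B * ln (real (m * n)) - c) + c * sqrt (Y * real m / H) * inverse (real a))
        = real m * ln \<delta> - real m * B * ln (real (m * n)) - c * real m + c * sqrt (real m * H) * sqrt Y"
    proof -
      \<comment> \<open>Summing over \<open>a\<close> turns \<open>1/a\<close> into
        \<open>H\<close>; this identity then yields the constant
        \<open>sqrt (m * H)\<close>.\<close>
      have 1: "sqrt (Y * real m / H) * H = sqrt (real m * H) * sqrt Y"
      proof -
        have "sqrt (Y * real m / H) * sqrt (H\<^sup>2) = sqrt (real m * H) * sqrt Y"
          using H unfolding real_sqrt_mult[symmetric] by (simp add: power2_eq_square mult_ac)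
        then show ?thesis using H by simp
      qed
      have 2: "(\<Sum>a=1..m. u + v * inverse (real a)) = real m * u + v * H" for u v
        by (simp add: sum.distrib sum_distrib_left[symmetric] H_def harm_def)
      show ?thesis
        unfolding 2 unfolding mult.assoc 1 by (simp add: right_diff_distrib distrib_left mult.assoc)
    qed
    moreover have "real m * ln \<delta> \<ge> - (real m * \<bar>ln \<delta>\<bar> * ln (real n))"
    proof -
      have "real m * \<bar>ln \<delta>\<bar> * 1 \<le> real m * \<bar>ln \<delta>\<bar> * ln (real n)" using ln1 by (intro mult_left_mono) auto
      moreover have "real m * (- \<bar>ln \<delta>\<bar>) \<le> real m * ln \<delta>" by (intro mult_left_mono) auto
      ultimately show ?thesis by simp
    qed
    moreover have "real m * B * ln (real (m * n)) \<le> 2 * real m * B * ln (real n)"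
      using mult_left_mono[OF mn, of "real m * B"] const by (simp add: mult_ac)
    moreover have "c * real m \<le> c * real m * ln (real n)"
      using mult_left_mono[OF ln1, of "c * real m"] c by simp
    moreover have "c * sqrt (real m * H) * sqrt Y \<ge> c * sqrt (real m * H) * sqrt (real n)
        - c * sqrt (real m * H) * (real m * (2 * \<kappa> * sqrt (real m) + 2)) * ln (real n)"
    proof -
      have r: "sqrt (real n) > 0" "sqrt (real n) \<ge> 1" using n by auto
      \<comment> \<open>\<open>n - Y = m * (K + 1)\<close> is at most of order
        \<open>sqrt n * ln n\<close>, and division by \<open>sqrt n\<close> leaves a logarithmic
        loss.\<close>
      have "sqrt (real n) - sqrt Y \<le> real m * (2 * \<kappa> * sqrt (real m) + 2) * ln (real n)"
      proof -
        have "(sqrt (real n) - sqrt Y) * sqrt (real n) \<le> (sqrt (real n) - sqrt Y) * (sqrt (real n) + sqrt Y)"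
          using Y Yn by (intro mult_left_mono) auto
        also have "\<dots> = real m * (real K + 1)"
          using Y n by (simp add: Y_def algebra_simps)
        also have "\<dots> \<le> real m * ((2 * \<kappa> * sqrt (real m) + 2) * (sqrt (real n) * ln (real n)))"
        proof (intro mult_left_mono)
          have "2 * (1 * 1) \<le> 2 * (sqrt (real n) * ln (real n))"
            using r ln1 by (intro mult_left_mono mult_mono) auto
          then show "real K + 1 \<le> (2 * \<kappa> * sqrt (real m) + 2) * (sqrt (real n) * ln (real n))"
            using K_le unfolding distrib_right by linarith
        qed simp
        finally have "(sqrt (real n) - sqrt Y) * sqrt (real n) \<le> (real m * (2 * \<kappa> * sqrt (real m) + 2) * ln (real n)) * sqrt (real n)"
          by (simp only: mult_ac)
        then show ?thesis using r(1) by (simp only: mult_le_cancel_right_pos)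
      qed
      then have "c * sqrt (real m * H) * (sqrt (real n) - sqrt Y) \<le> c * sqrt (real m * H) * (real m * (2 * \<kappa> * sqrt (real m) + 2) * ln (real n))"
        using c H by (intro mult_left_mono mult_nonneg_nonneg) auto
      then show ?thesis by (simp only: right_diff_distrib mult.assoc)
    qed
    ultimately have "ln (real (num_rect_partitions m n)) \<ge> c * sqrt (real m * H) * sqrt (real n) - A * ln (real n)"
      unfolding A_def distrib_right by argo
    then show ?case using p_pos by (simp only: C)
  qed
  then show ?thesis by (rule that)
qed

theorem theorem1p1:
  fixes m :: nat
  assumes "m \<ge> 1"
  shows "(\<lambda>n::nat. ln (real (num_rect_partitions m n))
            - pi * sqrt (2 * real m * harm m / 3) * sqrt (real n)) \<in> O(\<lambda>n. ln (real n))
       \<and> (\<forall>n::nat. n \<ge> m \<longrightarrow>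
           real (num_rect_partitions m n) \<le> exp (pi * sqrt (2 * real m * harm m / 3) * sqrt (real n)))"
proof (intro conjI allI impI)
  fix n assume "n \<ge> m"
  then show "real (num_rect_partitions m n) \<le> exp (pi * sqrt (2 * real m * harm m / 3) * sqrt (real n))"
    using num_rect_partitions_le assms by auto
next
  obtain A where A: "eventually (\<lambda>n. num_rect_partitions m n > 0 \<and>
     ln (real (num_rect_partitions m n)) \<ge> pi * sqrt (2 * real m * harm m / 3) * sqrt (real n) - A * ln (real n)) sequentially"
    using ln_num_rect_partitions_ge[OF assms] by blast
  show "(\<lambda>n::nat. ln (real (num_rect_partitions m n))
            - pi * sqrt (2 * real m * harm m / 3) * sqrt (real n)) \<in> O(\<lambda>n. ln (real n))"
  proof (rule bigoI[of _ A])
    show "eventually (\<lambda>n. norm (ln (real (num_rect_partitions m n))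
            - pi * sqrt (2 * real m * harm m / 3) * sqrt (real n)) \<le> A * norm (ln (real n))) sequentially"
      using A eventually_ge_at_top[of 1]
    proof eventually_elim
      case (elim n)
      \<comment> \<open>By this upper bound the difference is nonpositive, so the lower bound
        controls its absolute value.\<close>
      have "ln (real (num_rect_partitions m n)) \<le> pi * sqrt (2 * real m * harm m / 3) * sqrt (real n)"
        using num_rect_partitions_le[OF assms elim(2)] elim(1)
        by (subst exp_le_cancel_iff[symmetric]) simp
      moreover have "ln (real n) \<ge> 0" using elim(2) by simp
      ultimately show ?case using elim(1) by simp
    qed
  qed
qed

end
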